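(* Let $p\geq2$, $1/p+1/q=1$, $\Lambda\geq\lambda>0$, and let $\Omega\subset\mathbb{R}^n$ be open. Suppose that $A,B\in\mathcal{A}_{\lambda,\Lambda}(\Omega)$ satisfy $\Delta_p:=\min\{\Delta_p(A),\Delta_p(B)\}>0$. Then there exists $\delta=\delta(\Delta_p,\lambda,\Lambda)\in(0,1)$ such that for $Q=Q_{p,\delta}$ we have, for almost every $x\in\Omega$, $$ H_Q^{(A(x),B(x))}[v;\omega]\geq\frac{\Delta_p}{5}\cdot\frac{\lambda}{\Lambda}\,|\omega_1||\omega_2| $$ for any $v\in\mathbb{C}^2\setminus\Upsilon$ and $\omega=(\omega_1,\omega_2)\in\mathbb{C}^n\times\mathbb{C}^n$.
   Context: $\langle z,w\rangle=\sum_j z_j\overline{w_j}$ on $\mathbb{C}^n$. $\mathcal{A}_{\lambda,\Lambda}(\Omega)$ is the set of measurable $A:\Omega\to\mathbb{C}^{n\times n}$ such that for a.e. $x\in\Omega$: $\mathrm{Re}\langle A(x)\xi,\xi\rangle\geq\lambda|\xi|^2$ and $|\langle A(x)\xi,\eta\rangle|\leq\Lambda|\xi||\eta|$ for all $\xi,\eta\in\mathbb{C}^n$. For $p\in[1,\infty]$, $\mathcal{I}_p\xi=\xi+(1-2/p)\bar\xi$ and $\Delta_p(A)=\operatorname{ess\,inf}_{x\in\Omega}\min_{|\xi|=1}\mathrm{Re}\langle A(x)\xi,\mathcal{I}_p\xi\rangle$. Bellman function: for $p\geq2$, $q=p/(p-1)$, $\delta>0$, $Q=Q_{p,\delta}:\mathbb{C}\times\mathbb{C}\to[0,\infty)$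 is $$Q(\zeta,\eta)=|\zeta|^p+|\eta|^q+\delta\begin{cases}|\zeta|^2|\eta|^{2-q},&|\zeta|^p\leq|\eta|^q,\\ \frac2p|\zeta|^p+\left(\frac2q-1\right)|\eta|^q,&|\zeta|^p\geq|\eta|^q.\end{cases}$$ It is $C^1$ on $\mathbb{C}^2$ and $C^2$ off $\Upsilon=\{(\zeta,\eta)\in\mathbb{C}^2:\eta=0\text{ or }|\zeta|^p=|\eta|^q\}$. Generalized Hessian: for $A,B\in\mathbb{C}^{n\times n}$, $\Phi:\mathbb{C}^2\to\mathbb{R}$ twice differentiable at $v\in\mathbb{C}^2$, and $\omega=(\omega_1,\omega_2)\in\mathbb{C}^n\times\mathbb{C}^n$, $$H_\Phi^{(A,B)}[v;\omega]=\big\langle[\mathrm{Hess}\otimes I_{\mathbb{R}^n}]\,\mathcal{W}(\omega),[\mathcal{M}(A)\oplus\mathcal{M}(B)]\,\mathcal{W}(\omega)\big\rangle_{\mathbb{R}^{4n}},$$ where $\mathrm{Hess}$ is the real $4\times4$ Hessian of $\Phi$ at $v=(\zeta,\eta)$ in the real variables $(\mathrm{Re}\,\zeta,\mathrm{Im}\,\zeta,\mathrm{Re}\,\eta,\mathrm{Im}\,\eta)$, $\otimes$ is the Kronecker product ($[d_{ij}]\otimes I_{\mathbb{R}^n}=[d_{ij}I_n]$), $\mathcal{W}(\omega)=(\mathrm{Re}\,\omega_1,\mathrm{Im}\,\omega_1,\mathrm{Re}\,\omega_2,\mathrm{Im}\,\omega_2)\in(\mathbb{R}^n)^4$, $\mathcal{M}(A)=\begin{bmatrix}\mathrm{Re}A&-\mathrm{Im}A\\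 \mathrm{Im}A&\mathrm{Re}A\end{bmatrix}$ (entrywise real and imaginary parts), and $\oplus$ denotes the block-diagonal matrix. *)

theory Defs
  imports "HOL-Analysis.Analysis" "Jordan_Normal_Form.Matrix" "Jordan_Normal_Form.Conjugate"
begin

unbundle no inner_syntax
unbundle no vec_syntax

text \<open>
  The constant \<open>\<delta>\<close> of the theorem does not depend on the dimension \<open>n\<close>, so \<open>n\<close> has to be a
  quantifiable natural number rather than a type. Accordingly a point of real \<open>n\<close>-space is an
  extensional function in \<open>{..<n} \<rightarrow>\<^sub>E UNIV\<close>, while vectors in complex \<open>n\<close>-space and
  matrices are elements of \<open>carrier_vec n\<close> and \<open>carrier_mat n n\<close>.
\<close>

definition euclidean_top :: "nat \<Rightarrow> (nat \<Rightarrow> real) topology" where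
  "euclidean_top n = product_topology (\<lambda>_. euclideanreal) {..<n}"

definition lebesgue_dim :: "nat \<Rightarrow> (nat \<Rightarrow> real) measure" where
  "lebesgue_dim n = completion (\<Pi>\<^sub>M i\<in>{..<n}. lborel)"

definition lebesgue_dim_on :: "nat \<Rightarrow> (nat \<Rightarrow> real) set \<Rightarrow> (nat \<Rightarrow> real) measure" where
  "lebesgue_dim_on n \<Omega> = restrict_space (lebesgue_dim n) \<Omega>"

text \<open>The Hermitian product \<open>z \<bullet>c w\<close> of the matrix library is linear in \<open>z\<close> and
  conjugate linear in \<open>w\<close>.\<close>

definition cvec_norm :: "complex vec \<Rightarrow> real" where
  "cvec_norm z = sqrt (Re (z \<bullet>c z))"

definition elliptic ::
  "nat \<Rightarrow> real \<Rightarrow> real \<Rightarrow> (nat \<Rightarrow> real) set \<Rightarrow> ((nat \<Rightarrow> real) \<Rightarrow> complex mat) set" where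
  "elliptic n lam Lam \<Omega> = {A.
     (\<forall>x\<in>\<Omega>. A x \<in> carrier_mat n n) \<and>
     (\<forall>i<n. \<forall>j<n. (\<lambda>x. A x $$ (i, j)) \<in> borel_measurable (lebesgue_dim_on n \<Omega>)) \<and>
     (AE x in lebesgue_dim_on n \<Omega>. \<forall>\<xi>\<in>carrier_vec n. \<forall>\<eta>\<in>carrier_vec n.
        Re ((A x *\<^sub>v \<xi>) \<bullet>c \<xi>) \<ge> lam * (cvec_norm \<xi>)\<^sup>2 \<and>
        cmod ((A x *\<^sub>v \<xi>) \<bullet>c \<eta>) \<le> Lam * cvec_norm \<xi> * cvec_norm \<eta>)}"

definition I_op :: "real \<Rightarrow> complex vec \<Rightarrow> complex vec" where
  "I_op p \<xi> = \<xi> + complex_of_real (1 - 2 / p) \<cdot>\<^sub>v conjugate \<xi>"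

text \<open>For \<open>n \<ge> 1\<close> the infimum over the unit sphere is a minimum, by compactness. The limit
  inferior along the filter of almost everywhere true properties is the essential infimum; it is
  \<open>\<infinity>\<close> on a null set (in particular for empty \<open>\<Omega>\<close>).\<close>

definition Delta ::
  "nat \<Rightarrow> real \<Rightarrow> (nat \<Rightarrow> real) set \<Rightarrow> ((nat \<Rightarrow> real) \<Rightarrow> complex mat) \<Rightarrow> ereal" where
  "Delta n p \<Omega> A = Liminf (ae_filter (lebesgue_dim_on n \<Omega>))
     (\<lambda>x. ereal (INF \<xi>\<in>{\<xi> \<in> carrier_vec n. cvec_norm \<xi> = 1}. Re ((A x *\<^sub>v \<xi>) \<bullet>c I_op p \<xi>)))"

definition bellman_Q :: "real \<Rightarrow> real \<Rightarrow> complex \<times> complex \<Rightarrow> real" where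
  "bellman_Q p \<delta> = (\<lambda>(\<zeta>, \<eta>). let q = p / (p - 1) in
     cmod \<zeta> powr p + cmod \<eta> powr q +
     \<delta> * (if cmod \<zeta> powr p \<le> cmod \<eta> powr q
          then (cmod \<zeta>)\<^sup>2 * cmod \<eta> powr (2 - q)
          else 2 / p * cmod \<zeta> powr p + (2 / q - 1) * cmod \<eta> powr q))"

definition Upsilon :: "real \<Rightarrow> real \<Rightarrow> (complex \<times> complex) set" where
  "Upsilon p q = {(\<zeta>, \<eta>). \<eta> = 0 \<or> cmod \<zeta> powr p = cmod \<eta> powr q}"

text \<open>The coordinate directions of \<open>(Re \<zeta>, Im \<zeta>, Re \<eta>, Im \<eta>)\<close>.\<close>

definition coord_dir :: "nat \<Rightarrow> complex \<times> complex" where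
  "coord_dir i = [(1, 0), (\<i>, 0), (0, 1), (0, \<i>)] ! i"

definition hess :: "(complex \<times> complex \<Rightarrow> real) \<Rightarrow> complex \<times> complex \<Rightarrow> real mat" where
  "hess \<Phi> v = mat 4 4 (\<lambda>(i, j).
     deriv (\<lambda>s::real. deriv (\<lambda>t::real. \<Phi> (v + s *\<^sub>R coord_dir i + t *\<^sub>R coord_dir j)) 0) 0)"

definition kron_id :: "real mat \<Rightarrow> nat \<Rightarrow> real mat" where
  "kron_id D n = mat (dim_row D * n) (dim_col D * n)
     (\<lambda>(i, j). D $$ (i div n, j div n) * 1\<^sub>m n $$ (i mod n, j mod n))"

definition realify :: "complex mat \<Rightarrow> real mat" where
  "realify A = four_block_mat (map_mat Re A) (- map_mat Im A) (map_mat Im A) (map_mat Re A)"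

definition mat_dsum :: "real mat \<Rightarrow> real mat \<Rightarrow> real mat" where
  "mat_dsum M N = four_block_mat M (0\<^sub>m (dim_row M) (dim_col N)) (0\<^sub>m (dim_row N) (dim_col M)) N"

definition realify_vec :: "complex vec \<times> complex vec \<Rightarrow> real vec" where
  "realify_vec = (\<lambda>(\<omega>\<^sub>1, \<omega>\<^sub>2).
     map_vec Re \<omega>\<^sub>1 @\<^sub>v (map_vec Im \<omega>\<^sub>1 @\<^sub>v (map_vec Re \<omega>\<^sub>2 @\<^sub>v map_vec Im \<omega>\<^sub>2)))"

definition gen_hess ::
  "nat \<Rightarrow> (complex \<times> complex \<Rightarrow> real) \<Rightarrow> complex mat \<Rightarrow> complex mat \<Rightarrow>
   complex \<times> complex \<Rightarrow> complex vec \<times> complex vec \<Rightarrow> real" where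
  "gen_hess n \<Phi> A B v \<omega> =
     (kron_id (hess \<Phi> v) n *\<^sub>v realify_vec \<omega>) \<bullet>
     (mat_dsum (realify A) (realify B) *\<^sub>v realify_vec \<omega>)"

end

theory Submission
  imports Defs
begin

text \<open>
  On each side of the interface \<open>|\<zeta>|\<^sup>p = |\<eta>|\<^sup>q\<close> the function \<open>Q\<close> is built from powers of moduli, and
  \<open>H\<^sub>Q = \<Sum>\<^sub>k D\<^sup>2Q((A\<omega>\<^sub>1)\<^sub>k, (B\<omega>\<^sub>2)\<^sub>k; (\<omega>\<^sub>1)\<^sub>k, (\<omega>\<^sub>2)\<^sub>k)\<close>. Rotating \<open>\<omega>\<close> by \<open>\<zeta>/|\<zeta>|\<close> shows that the
  power \<open>|\<zeta>|\<^sup>p\<close> contributes at least \<open>p\<^sup>2/2 \<cdot> \<Delta>\<^sub>p |\<zeta>|\<^bsup>p-2\<^esup> |\<omega>\<^sub>1|\<^sup>2\<close>, and rotating by \<open>\<i>\<eta>/|\<eta>|\<close> that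
  \<open>|\<eta>|\<^sup>q\<close> contributes at least \<open>q\<^sup>2/2 \<cdot> \<Delta>\<^sub>p |\<eta>|\<^bsup>q-2\<^esup> |\<omega>\<^sub>2|\<^sup>2\<close>. Where \<open>|\<zeta>|\<^sup>p > |\<eta>|\<^sup>q\<close> the arithmetic-geometric
  mean inequality for these two terms suffices, because \<open>|\<zeta>|\<^bsup>p-2\<^esup> \<ge> |\<eta>|\<^bsup>2-q\<^esup>\<close>. Where
  \<open>|\<zeta>|\<^sup>p < |\<eta>|\<^sup>q\<close> the missing \<open>|\<omega>\<^sub>1|\<^sup>2\<close> term is supplied by \<open>\<delta> |\<zeta>|\<^sup>2 |\<eta>|\<^bsup>2-q\<^esup>\<close>, which gives
  \<open>2\<delta>\<lambda> |\<eta>|\<^bsup>2-q\<^esup> |\<omega>\<^sub>1|\<^sup>2\<close> up to errors controlled by \<open>\<delta>\<Lambda>\<close>. Taking \<open>\<delta> = \<Delta>\<^sub>p \<lambda> / (20 \<Lambda>\<^sup>2)\<close> balances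
  the two and yields the constant \<open>1/5\<close>.
\<close>

section \<open>The generalized Hessian through directional second derivatives\<close>

text \<open>\<open>hess\<close> iterates \<open>deriv\<close>, so the first derivative must be known
  at all points near \<open>v\<close>: the expression \<Psi> has to agree with \<Phi> on an open
  set, while the second derivative is required at \<open>v\<close> only.\<close>

lemma hess_eq_directional:
  fixes \<Phi> \<Psi> :: "complex \<times> complex \<Rightarrow> real"
  assumes "open U" "v \<in> U" and eq: "\<And>w. w \<in> U \<Longrightarrow> \<Phi> w = \<Psi> w"
    and G: "\<And>w d. w \<in> U \<Longrightarrow> ((\<lambda>t. \<Psi> (w + t *\<^sub>R d)) has_real_derivative G w d) (at 0)"
    and H: "\<And>d e. ((\<lambda>s. G (v + s *\<^sub>R d) e) has_real_derivative H d e) (at 0)"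
    and "i < 4" "j < 4"
  shows "hess \<Phi> v $$ (i, j) = H (coord_dir i) (coord_dir j)"
proof -
  have near: "\<forall>\<^sub>F t in nhds 0. w + t *\<^sub>R d \<in> U" if "w \<in> U" for w d
  proof -
    have "((\<lambda>t::real. w + t *\<^sub>R d) \<longlongrightarrow> w + 0 *\<^sub>R d) (nhds 0)"
      by (intro tendsto_intros filterlim_ident)
    then show ?thesis
      using topological_tendstoD[OF _ \<open>open U\<close>] that by fastforce
  qed
  have G': "((\<lambda>t. \<Phi> (w + t *\<^sub>R d)) has_real_derivative G w d) (at 0)" if "w \<in> U" for w d
  proof (rule DERIV_cong_ev[THEN iffD1, OF refl _ refl G[OF that]])
    show "\<forall>\<^sub>F t in nhds 0. \<Psi> (w + t *\<^sub>R d) = \<Phi> (w + t *\<^sub>R d)"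
      using near[OF that, of d] by eventually_elim (simp add: eq)
  qed
  have "((\<lambda>s. deriv (\<lambda>t. \<Phi> (v + s *\<^sub>R d + t *\<^sub>R e)) 0) has_real_derivative H d e) (at 0)" for d e
  proof (rule DERIV_cong_ev[THEN iffD1, OF refl _ refl H])
    show "\<forall>\<^sub>F s in nhds 0. G (v + s *\<^sub>R d) e = deriv (\<lambda>t. \<Phi> (v + s *\<^sub>R d + t *\<^sub>R e)) 0"
      using near[OF \<open>v \<in> U\<close>, of d] by eventually_elim (rule DERIV_imp_deriv[OF G', symmetric])
  qed
  then show ?thesis
    using assms(6,7) by (simp add: hess_def DERIV_imp_deriv)
qed

lemma less_4_cases: "(a::nat) < 4 \<Longrightarrow> a = 0 \<or> a = 1 \<or> a = 2 \<or> a = 3"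
  by auto

text \<open>Position \<open>k + a * n\<close> is entry \<open>k\<close> of block \<open>a\<close>,
  so grouping by \<open>k\<close> recovers one point of C^2 = R^4 per component.\<close>

lemma realify_vec_index:
  assumes "x \<in> carrier_vec n" "y \<in> carrier_vec n" "a < 4" "k < n"
  shows "realify_vec (x, y) $ (k + a * n) = inner (coord_dir a) (x $ k, y $ k)"
proof -
  have [simp]: "dim_vec x = n" "dim_vec y = n" using assms by auto
  from less_4_cases[OF \<open>a < 4\<close>] \<open>k < n\<close> show ?thesis
    by (auto simp: realify_vec_def coord_dir_def inner_prod_def inner_complex_def
        index_append_vec numeral_3_eq_3)
qed

text \<open>\<open>coord_dir\<close> runs through an orthonormal basis of C^2 over the
  reals.\<close>

lemma sum_coord_dir: "(\<Sum>a<4. inner (coord_dir a) v *\<^sub>R coord_dir a) = v"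
  by (cases v) (auto simp: eval_nat_numeral coord_dir_def inner_prod_def inner_complex_def complex_eq_iff
      scaleR_prod_def)

lemma realify_mult_vec:
  assumes "A \<in> carrier_mat n n" "x \<in> carrier_vec n"
  shows "realify A *\<^sub>v (map_vec Re x @\<^sub>v map_vec Im x) = map_vec Re (A *\<^sub>v x) @\<^sub>v map_vec Im (A *\<^sub>v x)"
proof -
  have d: "dim_row A = n" "dim_col A = n" "dim_vec x = n" using assms by auto
  show ?thesis
    unfolding realify_def
    apply (subst four_block_mat_mult_vec[where ?nr1.0=n and ?nr2.0=n and ?nc1.0=n and ?nc2.0=n])
    using assms d
    by (auto intro!: arg_cong2[where f=append_vec] simp: scalar_prod_def row_def sum_subtractf sum.distrib sum_negf
        algebra_simps)
qed

lemma mat_dsum_realify_mult_vec: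
  assumes "A \<in> carrier_mat n n" "B \<in> carrier_mat n n" "x \<in> carrier_vec n" "y \<in> carrier_vec n"
  shows "mat_dsum (realify A) (realify B) *\<^sub>v realify_vec (x, y) = realify_vec (A *\<^sub>v x, B *\<^sub>v y)"
proof -
  have d: "realify A \<in> carrier_mat (n + n) (n + n)" "realify B \<in> carrier_mat (n + n) (n + n)"
    using assms by (auto simp: realify_def)
  \<comment> \<open>\<open>realify_vec\<close> nests the appends to the right; the block product
    needs them grouped in two pairs.\<close>
  have v: "realify_vec (x', y') = (map_vec Re x' @\<^sub>v map_vec Im x') @\<^sub>v (map_vec Re y' @\<^sub>v map_vec Im y')"
    if "x' \<in> carrier_vec n" "y' \<in> carrier_vec n" for x' y'
    using that by (intro eq_vecI) (auto simp: realify_vec_def index_append_vec)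
  show ?thesis
    unfolding mat_dsum_def v[OF assms(3,4)] v[OF mult_mat_vec_carrier[OF assms(1,3)] mult_mat_vec_carrier[OF assms(2,4)]]
    using mult_mat_vec_split[OF d, of "map_vec Re x @\<^sub>v map_vec Im x" "map_vec Re y @\<^sub>v map_vec Im y"]
      d assms realify_mult_vec by (simp add: append_carrier_vec)
qed

lemma kron_id_mult_vec_index:
  assumes "D \<in> carrier_mat m l" "W \<in> carrier_vec (l * n)" "a < m" "k < n"
  shows "(kron_id D n *\<^sub>v W) $ (k + a * n) = (\<Sum>b<l. D $$ (a, b) * W $ (k + b * n))"
proof -
  \<comment> \<open>Keeps the flattened indices in range, so that entry lookups unfold.\<close>
  have lt: "j + b * n < c * n" if "b < c" "j < n" for b c j
    using mult_le_mono1[of "Suc b" c n] that by simp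
  have "(kron_id D n *\<^sub>v W) $ (k + a * n)
    = (\<Sum>i<l * n. kron_id D n $$ (k + a * n, i) * W $ i)"
    using assms lt[OF assms(3,4)] by (simp add: kron_id_def scalar_prod_def lessThan_atLeast0)
  also have "\<dots> = (\<Sum>b<l. \<Sum>j<n. D $$ (a, b) * (if k = j then W $ (j + b * n) else 0))"
    unfolding sum_mult_product using assms lt
    by (intro sum.cong refl) (auto simp: kron_id_def)
  also have "\<dots> = (\<Sum>b<l. D $$ (a, b) * W $ (k + b * n))"
    using assms(4) by (simp add: sum_distrib_left[symmetric])
  finally show ?thesis .
qed

text \<open>The identity factor of the Kronecker product couples only entries with the same
  \<open>k\<close>, so the form on R^(4n) splits into \<open>n\<close> forms on R^4. By bilinearity
  each of them is \<open>H\<close>, since \<open>hess\<close> lists the values of \<open>H\<close>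
  on an orthonormal basis.\<close>

lemma gen_hess_eq_sum:
  assumes A: "A \<in> carrier_mat n n" and B: "B \<in> carrier_mat n n"
    and x: "x \<in> carrier_vec n" and y: "y \<in> carrier_vec n"
    and H: "bilinear H"
    and hess: "\<And>i j. i < 4 \<Longrightarrow> j < 4 \<Longrightarrow> hess \<Phi> v $$ (i, j) = H (coord_dir i) (coord_dir j)"
  shows "gen_hess n \<Phi> A B v (x, y)
    = (\<Sum>k<n. H ((A *\<^sub>v x) $ k, (B *\<^sub>v y) $ k) (x $ k, y $ k))"
proof -
  let ?X = "\<lambda>k. (x $ k, y $ k)" and ?Y = "\<lambda>k. ((A *\<^sub>v x) $ k, (B *\<^sub>v y) $ k)"
  have c: "realify_vec (x', y') \<in> carrier_vec (4 * n)"
    if "x' \<in> carrier_vec n" "y' \<in> carrier_vec n" for x' y'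
    using that by (auto simp: realify_vec_def intro!: carrier_vecI)
  note Ax = mult_mat_vec_carrier[OF A x] and By = mult_mat_vec_carrier[OF B y]
  have D: "hess \<Phi> v \<in> carrier_mat 4 4" by (simp add: hess_def)
  have "gen_hess n \<Phi> A B v (x, y) =
      (\<Sum>r<4 * n. (kron_id (hess \<Phi> v) n *\<^sub>v realify_vec (x, y)) $ r * realify_vec (A *\<^sub>v x, B *\<^sub>v y) $ r)"
    using c[OF Ax By] unfolding gen_hess_def mat_dsum_realify_mult_vec[OF A B x y]
    by (simp add: scalar_prod_def lessThan_atLeast0)
  also have "\<dots> = (\<Sum>a<4. \<Sum>k<n. (\<Sum>b<4. H (coord_dir a) (coord_dir b) * inner (coord_dir b) (?X k))
      * inner (coord_dir a) (?Y k))"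
    unfolding sum_mult_product
    using kron_id_mult_vec_index[OF D c[OF x y]] realify_vec_index[OF x y] realify_vec_index[OF Ax By] hess
    by (intro sum.cong refl) simp
  also have "\<dots> = (\<Sum>k<n. \<Sum>a<4. \<Sum>b<4. H (inner (coord_dir a) (?Y k) *\<^sub>R coord_dir a)
      (inner (coord_dir b) (?X k) *\<^sub>R coord_dir b))"
    by (subst sum.swap) (simp add: bilinear_lmul[OF H] bilinear_rmul[OF H] sum_distrib_right
        sum_distrib_left mult_ac)
  also have "\<dots> = (\<Sum>k<n. H (?Y k) (?X k))"
    unfolding sum.cartesian_product bilinear_sum[OF H, symmetric] sum_coord_dir ..
  finally show ?thesis .
qed

section \<open>Derivatives of powers of the modulus\<close>

text \<open>At the origin \<open>0 powr 0 = 0\<close> would give the wrong second derivative of \<open>|z|\<^sup>2\<close>.\<close>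

definition pow_coeff :: "real \<Rightarrow> complex \<Rightarrow> real" where
  "pow_coeff a z = (if z = 0 \<and> a = 2 then 2 else a * cmod z powr (a - 2))"

definition pow_d1 :: "real \<Rightarrow> complex \<Rightarrow> complex \<Rightarrow> real" where
  "pow_d1 a z d = a * cmod z powr (a - 2) * inner z d"

definition pow_d2 :: "real \<Rightarrow> complex \<Rightarrow> complex \<Rightarrow> complex \<Rightarrow> real" where
  "pow_d2 a z d e = a * (a - 2) * cmod z powr (a - 4) * inner z d * inner z e + pow_coeff a z * inner d e"

lemma norm_powr_eq_inner_powr: "cmod z powr a = (inner z z) powr (a / 2)"
proof -
  have "inner z z = cmod z powr 2" by (simp add: dot_square_norm)
  then show ?thesis by (simp add: powr_powr del: powr_numeral)
qed

text \<open>|z|^a is a power of \<open>inner z z\<close>, which along a line is a quadratic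
  polynomial in \<open>t\<close>, positive at \<open>t = 0\<close>.\<close>

lemma norm_powr_line_deriv_nonzero:
  assumes "z \<noteq> 0"
  shows "((\<lambda>t. cmod (z + t *\<^sub>R d) powr a) has_real_derivative pow_d1 a z d) (at 0)"
proof -
  have "((\<lambda>t. (inner z z + 2 * t * inner z d + t\<^sup>2 * inner d d) powr (a / 2)) has_real_derivative
      a / 2 * inner z z powr (a / 2 - 1) * (2 * inner z d)) (at 0)"
    using assms by (auto intro!: derivative_eq_intros DERIV_fun_powr[THEN DERIV_cong])
  moreover have "inner z z + 2 * t * inner z d + t\<^sup>2 * inner d d = inner (z + t *\<^sub>R d) (z + t *\<^sub>R d)" for t
    by (simp add: inner_left_distrib inner_right_distrib inner_commute power2_eq_square)
  moreover have "a / 2 - 1 = (a - 2) / 2" by (simp add: field_simps)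
  ultimately have "((\<lambda>t. inner (z + t *\<^sub>R d) (z + t *\<^sub>R d) powr (a / 2)) has_real_derivative
      a / 2 * inner z z powr ((a - 2) / 2) * (2 * inner z d)) (at 0)"
    by (simp only:)
  moreover have "a / 2 * inner z z powr ((a - 2) / 2) * (2 * inner z d) = pow_d1 a z d"
    unfolding pow_d1_def norm_powr_eq_inner_powr by simp
  ultimately show ?thesis
    unfolding norm_powr_eq_inner_powr by (simp only:)
qed

text \<open>The difference quotient has modulus at most |h|^(c - 1), which tends to 0. This supplies
  the derivative of |z|^a at the origin.\<close>

lemma DERIV_abs_powr_0:
  assumes "c > (1::real)"
  shows "((\<lambda>t. \<bar>t\<bar> powr c) has_real_derivative 0) (at 0)"
proof -
  have le: "\<forall>\<^sub>F h in at 0. norm (\<bar>h\<bar> powr c / h) \<le> \<bar>h\<bar> powr (c - 1)"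
    by (auto simp: eventually_at_filter powr_diff)
  have "((\<lambda>h::real. \<bar>h\<bar> powr (c - 1)) \<longlongrightarrow> \<bar>0\<bar> powr (c - 1)) (at 0)"
    using assms by (intro tendsto_intros) auto
  then have lim: "((\<lambda>h::real. \<bar>h\<bar> powr (c - 1)) \<longlongrightarrow> 0) (at 0)"
    by (simp only: abs_zero powr_0)
  have "((\<lambda>h::real. \<bar>h\<bar> powr c / h) \<longlongrightarrow> 0) (at 0)"
    by (rule Lim_null_comparison[OF le lim])
  then show ?thesis using assms by (simp add: DERIV_def)
qed

lemma DERIV_abs_powr_mult_self_0:
  assumes "c > (0::real)"
  shows "((\<lambda>t. \<bar>t\<bar> powr c * t) has_real_derivative 0) (at 0)"
proof -
  have "((\<lambda>h::real. \<bar>h\<bar> powr c) \<longlongrightarrow> \<bar>0\<bar> powr c) (at 0)"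
    using assms by (intro tendsto_intros) auto
  then have "((\<lambda>h::real. \<bar>h\<bar> powr c * h / h) \<longlongrightarrow> \<bar>0\<bar> powr c) (at 0)"
    by (rule Lim_transform_eventually) (auto simp: eventually_at_filter)
  then show ?thesis using assms by (simp add: DERIV_def)
qed

text \<open>The origin has to be covered because points with \<zeta> = 0 and \<eta> nonzero lie off
  \<open>Upsilon\<close>. There the restriction to a line is |t|^a times a constant.\<close>

lemma norm_powr_line_deriv:
  assumes "z \<noteq> 0 \<or> a > 1"
  shows "((\<lambda>t. cmod (z + t *\<^sub>R d) powr a) has_real_derivative pow_d1 a z d) (at 0)"
proof (cases "z = 0")
  case True
  then have "((\<lambda>t. \<bar>t\<bar> powr a * cmod d powr a) has_real_derivative 0 * cmod d powr a) (at 0)"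
    using assms by (intro DERIV_cmult_right DERIV_abs_powr_0) auto
  then show ?thesis using True by (simp add: pow_d1_def powr_mult)
qed (use norm_powr_line_deriv_nonzero in auto)

lemma pow_d1_line_deriv:
  assumes "z \<noteq> 0 \<or> a \<ge> 2"
  shows "((\<lambda>s. pow_d1 a (z + s *\<^sub>R d) e) has_real_derivative pow_d2 a z d e) (at 0)"
proof -
  consider "z \<noteq> 0" | "z = 0" "a = 2" | "z = 0" "a > 2" using assms by fastforce
  then show ?thesis
  proof cases
    case 1
    have "((\<lambda>s. inner z e + s * inner d e) has_real_derivative inner d e) (at 0)"
      by (auto intro!: derivative_eq_intros)
    from DERIV_cmult[OF DERIV_mult[OF norm_powr_line_deriv_nonzero[OF 1, of d "a - 2"] this], of a]
    have "((\<lambda>s. pow_d1 a (z + s *\<^sub>R d) e) has_real_derivative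
        a * (pow_d1 (a - 2) z d * inner z e + inner d e * cmod z powr (a - 2))) (at 0)"
      by (simp add: pow_d1_def inner_left_distrib mult.assoc)
    moreover have "a * (pow_d1 (a - 2) z d * inner z e + inner d e * cmod z powr (a - 2)) = pow_d2 a z d e"
      using 1 by (simp add: pow_d1_def pow_d2_def pow_coeff_def distrib_left)
    ultimately show ?thesis by simp
  next
    case 2
    \<comment> \<open>The value \<open>0 powr 0 = 0\<close> is harmless here, because the inner
      product beside it vanishes as well.\<close>
    have "pow_d1 a (z + s *\<^sub>R d) e = s * (2 * inner d e)" for s
      using 2 by (cases "s = 0 \<or> d = 0") (auto simp: pow_d1_def)
    then show ?thesis using 2
      by (auto simp: pow_d2_def pow_coeff_def intro!: derivative_eq_intros)
  next
    case 3
    then have "((\<lambda>s. \<bar>s\<bar> powr (a - 2) * s * (a * cmod d powr (a - 2) * inner d e)) has_real_derivative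
        0 * (a * cmod d powr (a - 2) * inner d e)) (at 0)"
      by (intro DERIV_cmult_right DERIV_abs_powr_mult_self_0) auto
    then show ?thesis using 3
      by (simp add: pow_d1_def pow_d2_def pow_coeff_def powr_mult mult_ac)
  qed
qed

lemma bilinear_inner_combination:
  "bilinear (\<lambda>d e. c * inner z d * inner z e + c' * inner d e)"
proof -
  have "linear (\<lambda>d. c * inner z d * inner z e + c' * inner d e)"
    "linear (\<lambda>e. c * inner z d * inner z e + c' * inner d e)" for d e
    by (rule linearI; simp only: inner_add_left inner_add_right inner_scaleR_left inner_scaleR_right
        real_scaleR_def distrib_left distrib_right add_ac mult_ac)+
  then show ?thesis by (simp only: bilinear_def simp_thms)
qed

lemma bilinear_pow_d2: "bilinear (pow_d2 a z)"
  unfolding pow_d2_def[abs_def] by (rule bilinear_inner_combination)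

section \<open>Elliptic matrices\<close>

lemma Re_cscalar_prod_eq_sum:
  "Re (x \<bullet>c y) = (\<Sum>k<dim_vec y. inner (x $ k) (y $ k))"
  by (simp add: scalar_prod_def lessThan_atLeast0 inner_complex_def)

lemma cvec_norm_power2:
  assumes "x \<in> carrier_vec n"
  shows "(cvec_norm x)\<^sup>2 = (\<Sum>k<n. (cmod (x $ k))\<^sup>2)"
  using assms by (simp add: cvec_norm_def Re_cscalar_prod_eq_sum dot_square_norm sum_nonneg)

lemma cvec_norm_nonneg: "cvec_norm x \<ge> 0"
  by (simp add: cvec_norm_def Re_cscalar_prod_eq_sum sum_nonneg)

lemma cvec_norm_smult: "cvec_norm (c \<cdot>\<^sub>v x) = cmod c * cvec_norm x"
proof (rule power2_eq_imp_eq)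
  show "(cvec_norm (c \<cdot>\<^sub>v x))\<^sup>2 = (cmod c * cvec_norm x)\<^sup>2"
    using cvec_norm_power2[of "c \<cdot>\<^sub>v x" "dim_vec x"] cvec_norm_power2[of x "dim_vec x"]
    by (simp add: norm_mult power_mult_distrib sum_distrib_left)
qed (auto simp: cvec_norm_nonneg)

text \<open>The conditions that \<open>elliptic\<close> imposes almost everywhere, taken at one
  fixed point.\<close>

locale elliptic_matrix =
  fixes n :: nat and A :: "complex mat" and lam Lam :: real
  assumes carrier: "A \<in> carrier_mat n n"
    and lower: "x \<in> carrier_vec n \<Longrightarrow> lam * (cvec_norm x)\<^sup>2 \<le> Re ((A *\<^sub>v x) \<bullet>c x)"
    and upper: "x \<in> carrier_vec n \<Longrightarrow> y \<in> carrier_vec n \<Longrightarrow>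
      cmod ((A *\<^sub>v x) \<bullet>c y) \<le> Lam * cvec_norm x * cvec_norm y"
    and lam_pos: "0 < lam" and Lam_pos: "0 < Lam"
begin

lemma sum_inner_lower:
  assumes "x \<in> carrier_vec n"
  shows "lam * (cvec_norm x)\<^sup>2 \<le> (\<Sum>k<n. inner ((A *\<^sub>v x) $ k) (x $ k))"
  using lower[OF assms] assms by (simp add: Re_cscalar_prod_eq_sum)

text \<open>The components \<open>c k\<close> form a test vector for \<open>upper\<close>. Leaving
  them free admits projected or rescaled components of another vector.\<close>

lemma sum_inner_bound:
  assumes "x \<in> carrier_vec n" and "(\<Sum>k<n. (cmod (c k))\<^sup>2) \<le> M\<^sup>2" and "0 \<le> M"
  shows "\<bar>\<Sum>k<n. inner ((A *\<^sub>v x) $ k) (c k)\<bar> \<le> Lam * cvec_norm x * M"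
proof -
  have "\<bar>\<Sum>k<n. inner ((A *\<^sub>v x) $ k) (c k)\<bar> = \<bar>Re ((A *\<^sub>v x) \<bullet>c vec n c)\<bar>"
    by (simp add: Re_cscalar_prod_eq_sum)
  also have "\<dots> \<le> Lam * cvec_norm x * cvec_norm (vec n c)"
    using upper[OF assms(1), of "vec n c"] abs_Re_le_cmod[of "(A *\<^sub>v x) \<bullet>c vec n c"] by simp
  also have "\<dots> \<le> Lam * cvec_norm x * M"
  proof (rule mult_left_mono)
    have "(cvec_norm (vec n c))\<^sup>2 \<le> M\<^sup>2"
      using assms(2) by (simp add: cvec_norm_power2[of _ n])
    then show "cvec_norm (vec n c) \<le> M"
      using assms(3) by (rule power2_le_imp_le)
    show "0 \<le> Lam * cvec_norm x"
      using Lam_pos cvec_norm_nonneg by (intro mult_nonneg_nonneg) auto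
  qed
  finally show ?thesis .
qed

lemma sum_pow_d2_2:
  assumes "x \<in> carrier_vec n"
  shows "2 * lam * (cvec_norm x)\<^sup>2 \<le> (\<Sum>k<n. pow_d2 2 z ((A *\<^sub>v x) $ k) (x $ k))"
  using sum_inner_lower[OF assms] by (simp add: pow_d2_def pow_coeff_def flip: sum_distrib_left)

end

text \<open>Polar form of the Hessian of |z|^a: up to a scalar factor, the identity plus
  \<open>a - 2\<close> times the projection onto the radial direction \<open>sgn z\<close>.\<close>

lemma pow_d2_sgn:
  assumes "z \<noteq> 0"
  shows "pow_d2 a z d e = a * cmod z powr (a - 2) * (inner d e + (a - 2) * (inner (sgn z) d * inner (sgn z) e))"
proof -
  have "inner z u = cmod z * inner (sgn z) u" for u
    using assms by (simp add: sgn_div_norm)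
  moreover have "cmod z powr (a - 2) = cmod z powr (a - 4) * (cmod z * cmod z)"
    using assms powr_add[of "cmod z" "a - 4" 2] by (simp add: power2_eq_square)
  ultimately show ?thesis using assms by (simp add: pow_d2_def pow_coeff_def algebra_simps)
qed

context elliptic_matrix
begin

text \<open>The polar form contains the identity minus \<open>q\<close> times the radial projection,
  with eigenvalues 1 and 1 - q. For \<open>q\<close> between 0 and 2 this is a contraction, so the
  bound \<Lambda> survives unchanged.\<close>

lemma abs_sum_pow_d2_2_minus:
  assumes x: "x \<in> carrier_vec n" and z: "z \<noteq> 0" and q: "0 \<le> q" "q \<le> 2"
  shows "\<bar>\<Sum>k<n. pow_d2 (2 - q) z ((A *\<^sub>v x) $ k) (x $ k)\<bar>
    \<le> (2 - q) * cmod z powr (- q) * Lam * (cvec_norm x)\<^sup>2"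
proof -
  let ?e = "sgn z"
  let ?c = "\<lambda>k. x $ k - (q * inner ?e (x $ k)) *\<^sub>R ?e"
  have e: "inner ?e ?e = 1" using z by (simp add: dot_square_norm norm_sgn)
  \<comment> \<open>The contraction made explicit: q (2 - q) is nonnegative.\<close>
  have "(cmod (u - (q * inner ?e u) *\<^sub>R ?e))\<^sup>2 = (cmod u)\<^sup>2 - q * (2 - q) * (inner ?e u)\<^sup>2" for u
    unfolding power2_norm_eq_inner using e
    by (simp add: inner_diff_left inner_diff_right inner_commute[of u ?e] power2_eq_square algebra_simps)
  then have "(\<Sum>k<n. (cmod (?c k))\<^sup>2) \<le> (cvec_norm x)\<^sup>2"
    unfolding cvec_norm_power2[OF x] using q by (intro sum_mono) simp
  from sum_inner_bound[OF x this cvec_norm_nonneg]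
  have "\<bar>\<Sum>k<n. inner ((A *\<^sub>v x) $ k) (?c k)\<bar> \<le> Lam * (cvec_norm x)\<^sup>2"
    by (simp add: power2_eq_square mult.assoc)
  then have "((2 - q) * cmod z powr (- q)) * \<bar>\<Sum>k<n. inner ((A *\<^sub>v x) $ k) (?c k)\<bar>
      \<le> ((2 - q) * cmod z powr (- q)) * (Lam * (cvec_norm x)\<^sup>2)"
    using q by (intro mult_left_mono) auto
  moreover have "(\<Sum>k<n. pow_d2 (2 - q) z ((A *\<^sub>v x) $ k) (x $ k))
      = ((2 - q) * cmod z powr (- q)) * (\<Sum>k<n. inner ((A *\<^sub>v x) $ k) (?c k))"
    unfolding sum_distrib_left pow_d2_sgn[OF z]
    by (intro sum.cong refl) (simp add: inner_diff_right inner_commute)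
  ultimately show ?thesis using q by (simp add: abs_mult mult.assoc)
qed

text \<open>Moving the scalar \<open>inner w (y $ k)\<close> onto \<open>z\<close> turns the sum
  into a pairing of \<open>A *\<^sub>v x\<close> with one test vector, of norm at most
  |z||w||y|.\<close>

lemma abs_sum_inner_mult_inner:
  assumes x: "x \<in> carrier_vec n" and y: "y \<in> carrier_vec n"
  shows "\<bar>\<Sum>k<n. inner z ((A *\<^sub>v x) $ k) * inner w (y $ k)\<bar>
    \<le> Lam * cmod z * cmod w * cvec_norm x * cvec_norm y"
proof -
  have "(\<Sum>k<n. (cmod (inner w (y $ k) *\<^sub>R z))\<^sup>2) \<le> (\<Sum>k<n. (cmod z * cmod w)\<^sup>2 * (cmod (y $ k))\<^sup>2)"
  proof (rule sum_mono)
    fix k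
    have "\<bar>inner w (y $ k)\<bar> * cmod z \<le> cmod w * cmod (y $ k) * cmod z"
      using Cauchy_Schwarz_ineq2 by (intro mult_right_mono) auto
    from power_mono[OF this, of 2]
    show "(cmod (inner w (y $ k) *\<^sub>R z))\<^sup>2 \<le> (cmod z * cmod w)\<^sup>2 * (cmod (y $ k))\<^sup>2"
      by (simp add: power_mult_distrib mult_ac)
  qed
  also have "\<dots> = (cmod z * cmod w * cvec_norm y)\<^sup>2"
    by (simp add: power_mult_distrib cvec_norm_power2[OF y] sum_distrib_left)
  finally have "\<bar>\<Sum>k<n. inner ((A *\<^sub>v x) $ k) (inner w (y $ k) *\<^sub>R z)\<bar>
      \<le> Lam * cvec_norm x * (cmod z * cmod w * cvec_norm y)"
    by (intro sum_inner_bound[OF x]) (auto simp: cvec_norm_nonneg)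
  then show ?thesis by (simp add: inner_commute mult_ac)
qed

end

section \<open>p-ellipticity and the convexity of the pure powers\<close>

locale p_elliptic_matrix = elliptic_matrix +
  fixes p D :: real
  assumes p_ge_2: "2 \<le> p" and D_pos: "0 < D"
    and p_lower: "x \<in> carrier_vec n \<Longrightarrow> D * (cvec_norm x)\<^sup>2 \<le> Re ((A *\<^sub>v x) \<bullet>c I_op p x)"
begin

text \<open>\<open>p_lower\<close> is applied to \<open>cnj e \<cdot>\<^sub>v x\<close>, which has
  the norm of \<open>x\<close> and commutes past \<open>A\<close>. \<open>I_op\<close> is only real
  linear, so the rotation matters: it turns the real axis, which \<open>I_op\<close> singles out,
  into the direction \<open>e\<close>.\<close>

lemma sum_rotated_lower:
  assumes x: "x \<in> carrier_vec n" and e: "cmod e = 1"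
  shows "p / 2 * D * (cvec_norm x)\<^sup>2 \<le> (\<Sum>k<n. inner ((A *\<^sub>v x) $ k) (x $ k)
    + (p - 2) * (inner e ((A *\<^sub>v x) $ k) * inner e (x $ k)))"
proof -
  have e2: "(Re e)\<^sup>2 + (Im e)\<^sup>2 = 1" using e by (simp add: cmod_power2[symmetric])
  \<comment> \<open>\<open>I_op\<close> multiplies real parts by 2 - 2/p and imaginary parts by 2/p;
    the factor p/2 makes these p - 1 and 1, that is, the identity plus p - 2 on the real
    part.\<close>
  have *: "p / 2 * inner (cnj e * y) (cnj e * u + complex_of_real (1 - 2 / p) * cnj (cnj e * u))
      = inner y u + (p - 2) * (inner e y * inner e u)" for y u :: complex
  proof -
    have "p * (1 - 2 / p) = p - 2" using p_ge_2 by (simp add: field_simps)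
    then have "p / 2 * inner \<tau> (\<sigma> + complex_of_real (1 - 2 / p) * cnj \<sigma>)
      = inner \<tau> \<sigma> + (p - 2) * (Re \<tau> * Re \<sigma>)" for \<tau> \<sigma>
      unfolding inner_complex_def using p_ge_2 by (simp add: field_simps)
    moreover have "inner (cnj e * y) (cnj e * u) = ((Re e)\<^sup>2 + (Im e)\<^sup>2) * inner y u"
      by (simp add: inner_complex_def power2_eq_square algebra_simps)
    moreover have "Re (cnj e * w) = inner e w" for w by (simp add: inner_complex_def)
    ultimately show ?thesis by (simp only: e2 mult_1_left)
  qed
  have c: "cnj e \<cdot>\<^sub>v x \<in> carrier_vec n" "I_op p (cnj e \<cdot>\<^sub>v x) \<in> carrier_vec n"
    using x by (auto simp: I_op_def)
  have "D * (cvec_norm x)\<^sup>2 \<le> Re ((A *\<^sub>v (cnj e \<cdot>\<^sub>v x)) \<bullet>c I_op p (cnj e \<cdot>\<^sub>v x))"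
    using p_lower[OF c(1)] e by (simp add: cvec_norm_smult)
  also have "\<dots> = (\<Sum>k<n. inner (cnj e * (A *\<^sub>v x) $ k)
      (cnj e * x $ k + complex_of_real (1 - 2 / p) * cnj (cnj e * x $ k)))"
    unfolding Re_cscalar_prod_eq_sum mult_mat_vec[OF carrier x]
    using x carrier by (intro sum.cong) (auto simp: I_op_def)
  finally have "p / 2 * (D * (cvec_norm x)\<^sup>2) \<le> p / 2 * \<dots>"
    by (rule mult_left_mono) (use p_ge_2 in simp)
  then show ?thesis unfolding sum_distrib_left * by (simp only: mult.assoc)
qed

text \<open>With \<open>e = sgn z\<close> the rotated form is exactly the polar form of the Hessian
  of |z|^p.\<close>

lemma sum_pow_d2_p:
  assumes x: "x \<in> carrier_vec n"
  shows "p\<^sup>2 / 2 * D * cmod z powr (p - 2) * (cvec_norm x)\<^sup>2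
    \<le> (\<Sum>k<n. pow_d2 p z ((A *\<^sub>v x) $ k) (x $ k))"
proof (cases "z = 0")
  case True
  \<comment> \<open>\<open>0 powr (p - 2)\<close> is 0, also for p = 2, so at the origin only
    nonnegativity is claimed.\<close>
  have "0 \<le> (\<Sum>k<n. inner ((A *\<^sub>v x) $ k) (x $ k))"
    using sum_inner_lower[OF x] lam_pos by (smt (verit) mult_nonneg_nonneg zero_le_power2)
  then have "0 \<le> pow_coeff p z * (\<Sum>k<n. inner ((A *\<^sub>v x) $ k) (x $ k))"
    using p_ge_2 by (auto simp: pow_coeff_def)
  with True show ?thesis by (simp add: pow_d2_def sum_distrib_left)
next
  case False
  have "p * cmod z powr (p - 2) * (p / 2 * D * (cvec_norm x)\<^sup>2) \<le>
      (\<Sum>k<n. pow_d2 p z ((A *\<^sub>v x) $ k) (x $ k))"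
    unfolding pow_d2_sgn[OF False] sum_distrib_left[symmetric]
    using sum_rotated_lower[OF x, of "sgn z"] p_ge_2 False
    by (intro mult_left_mono) (auto simp: norm_sgn)
  then show ?thesis by (simp add: power2_eq_square mult_ac)
qed

text \<open>Multiplying the rotation by \<open>\<i>\<close> exchanges the exponents \<open>p\<close> and \<open>q\<close>.\<close>

lemma sum_pow_d2_q:
  assumes x: "x \<in> carrier_vec n" and z: "z \<noteq> 0" and q: "q = p / (p - 1)"
  shows "q\<^sup>2 / 2 * D * cmod z powr (q - 2) * (cvec_norm x)\<^sup>2
    \<le> (\<Sum>k<n. pow_d2 q z ((A *\<^sub>v x) $ k) (x $ k))"
proof -
  define e where "e = sgn z"
  have e: "cmod e = 1" using z by (simp add: norm_sgn e_def)
  then have e2: "(Re e)\<^sup>2 + (Im e)\<^sup>2 = 1" by (simp add: cmod_power2[symmetric])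
  \<comment> \<open>\<open>e\<close> and \<open>\<i> * e\<close> form an orthonormal basis of the
    plane.\<close>
  have rot: "inner (\<i> * e) y * inner (\<i> * e) u = inner y u - inner e y * inner e u" for y u
  proof -
    have "inner (\<i> * e) y * inner (\<i> * e) u + inner e y * inner e u
        = ((Re e)\<^sup>2 + (Im e)\<^sup>2) * inner y u"
      unfolding inner_complex_def by (simp add: power2_eq_square algebra_simps)
    with e2 show ?thesis by simp
  qed
  have q': "(p - 1) * (q - 2) = 2 - p" "(p - 1) * q = p" "0 \<le> q"
    using p_ge_2 unfolding q by (simp_all add: field_simps)
  have "(p - 1) * (q / 2 * D * (cvec_norm x)\<^sup>2) = p / 2 * D * (cvec_norm x)\<^sup>2"
    using q'(2) by (metis (no_types, opaque_lifting) mult.assoc times_divide_eq_right)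
  also have "\<dots> \<le> (\<Sum>k<n. inner ((A *\<^sub>v x) $ k) (x $ k)
    + (p - 2) * (inner (\<i> * e) ((A *\<^sub>v x) $ k) * inner (\<i> * e) (x $ k)))"
    using e by (intro sum_rotated_lower[OF x]) (simp add: norm_mult)
  \<comment> \<open>The identity plus p - 2 times the tangential projection equals p - 1 times the
    sum of the identity and q - 2 times the radial projection, because (p - 1)(q - 2) = 2 -
    p.\<close>
  also have "\<dots> = (\<Sum>k<n. (p - 1) * inner ((A *\<^sub>v x) $ k) (x $ k)
    + ((p - 1) * (q - 2)) * (inner e ((A *\<^sub>v x) $ k) * inner e (x $ k)))"
    unfolding rot q' by (simp add: algebra_simps)
  also have "\<dots> = (p - 1) * (\<Sum>k<n. inner ((A *\<^sub>v x) $ k) (x $ k)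
    + (q - 2) * (inner e ((A *\<^sub>v x) $ k) * inner e (x $ k)))"
    unfolding sum_distrib_left by (simp only: distrib_left mult.assoc)
  finally have "q / 2 * D * (cvec_norm x)\<^sup>2 \<le> (\<Sum>k<n. inner ((A *\<^sub>v x) $ k) (x $ k)
    + (q - 2) * (inner e ((A *\<^sub>v x) $ k) * inner e (x $ k)))"
    using p_ge_2 by simp
  then have "q * cmod z powr (q - 2) * (q / 2 * D * (cvec_norm x)\<^sup>2) \<le>
      (\<Sum>k<n. pow_d2 q z ((A *\<^sub>v x) $ k) (x $ k))"
    unfolding pow_d2_sgn[OF z] e_def sum_distrib_left[symmetric]
    using q' by (intro mult_left_mono) auto
  then show ?thesis by (simp add: power2_eq_square mult_ac)
qed

end

section \<open>The Hessian of the Bellman function\<close>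

lemma linear_pow_d1: "linear (pow_d1 a z)"
  by (rule linearI; simp only: pow_d1_def inner_add_right inner_scaleR_right real_scaleR_def
      distrib_left distrib_right mult_ac)

text \<open>Derivative of c|\<zeta>|^p + c'|\<eta>|^q. Both branches of Q contain such a sum, with
  coefficients 1 where |\<zeta>|^p < |\<eta>|^q and with \<delta> absorbed into them on the other
  side.\<close>

definition separate_d1 ::
  "real \<Rightarrow> real \<Rightarrow> real \<Rightarrow> real \<Rightarrow> complex \<times> complex \<Rightarrow> complex \<times> complex \<Rightarrow> real" where
  "separate_d1 c c' p q v d = c * pow_d1 p (fst v) (fst d) + c' * pow_d1 q (snd v) (snd d)"

definition separate_d2 ::
  "real \<Rightarrow> real \<Rightarrow> real \<Rightarrow> real \<Rightarrow> complex \<times> complex \<Rightarrow>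
    complex \<times> complex \<Rightarrow> complex \<times> complex \<Rightarrow> real" where
  "separate_d2 c c' p q v d e = c * pow_d2 p (fst v) (fst d) (fst e) + c' * pow_d2 q (snd v) (snd d) (snd e)"

lemma separate_line_deriv:
  assumes "2 \<le> p" "snd v \<noteq> 0"
  shows "((\<lambda>t. c * cmod (fst (v + t *\<^sub>R d)) powr p + c' * cmod (snd (v + t *\<^sub>R d)) powr q)
      has_real_derivative separate_d1 c c' p q v d) (at 0)"
    and "((\<lambda>t. separate_d1 c c' p q (v + t *\<^sub>R d) e) has_real_derivative
      separate_d2 c c' p q v d e) (at 0)"
  unfolding separate_d1_def separate_d2_def fst_add snd_add fst_scaleR snd_scaleR
  using assms by (intro DERIV_add DERIV_cmult norm_powr_line_deriv pow_d1_line_deriv; simp)+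

lemma bilinear_separate_d2: "bilinear (separate_d2 c c' p q v)"
  unfolding bilinear_def separate_d2_def
  by (intro conjI allI linearI; simp only: fst_add snd_add fst_scaleR snd_scaleR
      bilinear_ladd[OF bilinear_pow_d2] bilinear_radd[OF bilinear_pow_d2]
      bilinear_lmul[OF bilinear_pow_d2] bilinear_rmul[OF bilinear_pow_d2]
      real_scaleR_def distrib_left add_ac mult_ac)

text \<open>Derivative of |\<zeta>|^2 |\<eta>|^(2-q). The square is written with \<open>powr\<close>
  so that the rules for powers of the modulus apply.\<close>

definition product_d1 ::
  "real \<Rightarrow> complex \<times> complex \<Rightarrow> complex \<times> complex \<Rightarrow> real" where
  "product_d1 q v d = pow_d1 2 (fst v) (fst d) * cmod (snd v) powr (2 - q)
    + pow_d1 (2 - q) (snd v) (snd d) * cmod (fst v) powr 2"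

definition product_d2 ::
  "real \<Rightarrow> complex \<times> complex \<Rightarrow> complex \<times> complex \<Rightarrow> complex \<times> complex \<Rightarrow> real" where
  "product_d2 q v d e =
    pow_d2 2 (fst v) (fst d) (fst e) * cmod (snd v) powr (2 - q)
      + pow_d1 (2 - q) (snd v) (snd d) * pow_d1 2 (fst v) (fst e)
      + (pow_d2 (2 - q) (snd v) (snd d) (snd e) * cmod (fst v) powr 2
      + pow_d1 2 (fst v) (fst d) * pow_d1 (2 - q) (snd v) (snd e))"

lemma product_line_deriv:
  assumes "snd v \<noteq> 0"
  shows "((\<lambda>t. cmod (fst (v + t *\<^sub>R d)) powr 2 * cmod (snd (v + t *\<^sub>R d)) powr (2 - q))
      has_real_derivative product_d1 q v d) (at 0)"
    and "((\<lambda>t. product_d1 q (v + t *\<^sub>R d) e) has_real_derivative product_d2 q v d e) (at 0)"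
proof -
  have z: "((\<lambda>t. cmod (fst v + t *\<^sub>R fst d) powr 2) has_real_derivative pow_d1 2 (fst v) (fst d)) (at 0)"
    "((\<lambda>t. pow_d1 2 (fst v + t *\<^sub>R fst d) (fst e)) has_real_derivative pow_d2 2 (fst v) (fst d) (fst e)) (at 0)"
    by (rule norm_powr_line_deriv pow_d1_line_deriv; simp)+
  have w: "((\<lambda>t. cmod (snd v + t *\<^sub>R snd d) powr (2 - q)) has_real_derivative
      pow_d1 (2 - q) (snd v) (snd d)) (at 0)"
    "((\<lambda>t. pow_d1 (2 - q) (snd v + t *\<^sub>R snd d) (snd e)) has_real_derivative
      pow_d2 (2 - q) (snd v) (snd d) (snd e)) (at 0)"
    using assms by (auto intro: norm_powr_line_deriv pow_d1_line_deriv)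
  show "((\<lambda>t. cmod (fst (v + t *\<^sub>R d)) powr 2 * cmod (snd (v + t *\<^sub>R d)) powr (2 - q))
      has_real_derivative product_d1 q v d) (at 0)"
    unfolding fst_add snd_add fst_scaleR snd_scaleR product_d1_def
    using DERIV_mult[OF z(1) w(1)] by (simp only: scaleR_zero_left add_0_right)
  show "((\<lambda>t. product_d1 q (v + t *\<^sub>R d) e) has_real_derivative product_d2 q v d e) (at 0)"
    unfolding fst_add snd_add fst_scaleR snd_scaleR product_d1_def product_d2_def
    using DERIV_add[OF DERIV_mult[OF z(2) w(1)] DERIV_mult[OF w(2) z(1)]]
    by (simp only: scaleR_zero_left add_0_right)
qed

lemma bilinear_product_d2: "bilinear (product_d2 q v)"
  unfolding bilinear_def product_d2_def
  by (intro conjI allI linearI; simp only: fst_add snd_add fst_scaleR snd_scaleR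
      bilinear_ladd[OF bilinear_pow_d2] bilinear_radd[OF bilinear_pow_d2]
      bilinear_lmul[OF bilinear_pow_d2] bilinear_rmul[OF bilinear_pow_d2]
      linear_add[OF linear_pow_d1] linear_cmul[OF linear_pow_d1]
      real_scaleR_def distrib_left distrib_right add_ac mult_ac)

lemma bilinear_add_scale:
  assumes "bilinear f" "bilinear g"
  shows "bilinear (\<lambda>d e. f d e + (c::real) * g d e)"
  unfolding bilinear_def
  by (intro conjI allI linearI; simp only: bilinear_ladd[OF assms(1)] bilinear_radd[OF assms(1)]
      bilinear_lmul[OF assms(1)] bilinear_rmul[OF assms(1)] bilinear_ladd[OF assms(2)] bilinear_radd[OF assms(2)]
      bilinear_lmul[OF assms(2)] bilinear_rmul[OF assms(2)]
      real_scaleR_def distrib_left add_ac mult_ac)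

text \<open>The complement of \<open>Upsilon\<close> is the union of these two open sets; on each a
  single branch of Q is in force.\<close>

lemma open_norm_powr_less:
  assumes "0 < p" "0 < q"
  shows "open {v :: complex \<times> complex. snd v \<noteq> 0 \<and> cmod (fst v) powr p < cmod (snd v) powr q}"
    and "open {v :: complex \<times> complex. snd v \<noteq> 0 \<and> cmod (snd v) powr q < cmod (fst v) powr p}"
proof -
  have c: "continuous_on UNIV (\<lambda>v :: complex \<times> complex. cmod (fst v) powr p)"
    "continuous_on UNIV (\<lambda>v :: complex \<times> complex. cmod (snd v) powr q)"
    by (rule continuous_on_powr'; use assms in \<open>auto intro!: continuous_intros\<close>)+
  have "open {v :: complex \<times> complex. snd v \<noteq> 0}"
    by (intro open_Collect_neq continuous_intros)
  then show "open {v :: complex \<times> complex. snd v \<noteq> 0 \<and> cmod (fst v) powr p < cmod (snd v) powr q}"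
    "open {v :: complex \<times> complex. snd v \<noteq> 0 \<and> cmod (snd v) powr q < cmod (fst v) powr p}"
    using c by (auto intro!: open_Collect_conj open_Collect_less)
qed

lemma hess_bellman_Q_inner:
  assumes p: "2 \<le> p" and q: "q = p / (p - 1)" and v: "snd v \<noteq> 0"
    "cmod (fst v) powr p < cmod (snd v) powr q" and ij: "i < 4" "j < 4"
  shows "hess (bellman_Q p \<delta>) v $$ (i, j) =
    separate_d2 1 1 p q v (coord_dir i) (coord_dir j) + \<delta> * product_d2 q v (coord_dir i) (coord_dir j)"
proof (rule hess_eq_directional[OF open_norm_powr_less(1)[of p q] _ _ _ _ ij])
  show "bellman_Q p \<delta> w = (1 * cmod (fst w) powr p + 1 * cmod (snd w) powr q)
      + \<delta> * (cmod (fst w) powr 2 * cmod (snd w) powr (2 - q))"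
    if "w \<in> {v. snd v \<noteq> 0 \<and> cmod (fst v) powr p < cmod (snd v) powr q}" for w
    using that by (auto simp: bellman_Q_def Let_def q split: prod.splits)
next
  fix w d :: "complex \<times> complex"
  assume "w \<in> {v. snd v \<noteq> 0 \<and> cmod (fst v) powr p < cmod (snd v) powr q}"
  then have w: "snd w \<noteq> 0" by simp
  show "((\<lambda>t. (1 * cmod (fst (w + t *\<^sub>R d)) powr p + 1 * cmod (snd (w + t *\<^sub>R d)) powr q)
      + \<delta> * (cmod (fst (w + t *\<^sub>R d)) powr 2 * cmod (snd (w + t *\<^sub>R d)) powr (2 - q)))
    has_real_derivative separate_d1 1 1 p q w d + \<delta> * product_d1 q w d) (at 0)"
    by (intro DERIV_add DERIV_cmult separate_line_deriv(1) product_line_deriv(1) p w)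
next
  show "((\<lambda>s. separate_d1 1 1 p q (v + s *\<^sub>R d) e + \<delta> * product_d1 q (v + s *\<^sub>R d) e)
    has_real_derivative separate_d2 1 1 p q v d e + \<delta> * product_d2 q v d e) (at 0)" for d e
    by (intro DERIV_add DERIV_cmult separate_line_deriv(2) product_line_deriv(2) p v)
qed (use p q v in auto)

lemma hess_bellman_Q_outer:
  assumes p: "2 \<le> p" and q: "q = p / (p - 1)" and v: "snd v \<noteq> 0"
    "cmod (snd v) powr q < cmod (fst v) powr p" and ij: "i < 4" "j < 4"
  shows "hess (bellman_Q p \<delta>) v $$ (i, j) =
    separate_d2 (1 + \<delta> * (2 / p)) (1 + \<delta> * (2 / q - 1)) p q v (coord_dir i) (coord_dir j)"
proof (rule hess_eq_directional[OF open_norm_powr_less(2)[of p q] _ _ _ _ ij])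
  show "bellman_Q p \<delta> w = (1 + \<delta> * (2 / p)) * cmod (fst w) powr p + (1 + \<delta> * (2 / q - 1)) * cmod (snd w) powr q"
    if "w \<in> {v. snd v \<noteq> 0 \<and> cmod (snd v) powr q < cmod (fst v) powr p}" for w
  proof -
    obtain z y where w: "w = (z, y)" by (cases w)
    with that have "\<not> cmod z powr p \<le> cmod y powr q" by simp
    then show ?thesis by (simp add: w bellman_Q_def Let_def q[symmetric] distrib_left distrib_right mult.assoc)
  qed
next
  fix w d :: "complex \<times> complex"
  assume "w \<in> {v. snd v \<noteq> 0 \<and> cmod (snd v) powr q < cmod (fst v) powr p}"
  then show "((\<lambda>t. (1 + \<delta> * (2 / p)) * cmod (fst (w + t *\<^sub>R d)) powr p
      + (1 + \<delta> * (2 / q - 1)) * cmod (snd (w + t *\<^sub>R d)) powr q)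
    has_real_derivative separate_d1 (1 + \<delta> * (2 / p)) (1 + \<delta> * (2 / q - 1)) p q w d) (at 0)"
    by (intro separate_line_deriv(1) p) simp
next
  show "((\<lambda>s. separate_d1 (1 + \<delta> * (2 / p)) (1 + \<delta> * (2 / q - 1)) p q (v + s *\<^sub>R d) e)
    has_real_derivative separate_d2 (1 + \<delta> * (2 / p)) (1 + \<delta> * (2 / q - 1)) p q v d e) (at 0)" for d e
    by (intro separate_line_deriv(2) p v)
qed (use p q v in auto)

section \<open>The lower bound\<close>

text \<open>Take p-th roots, with q/p = q - 1.\<close>

lemma powr_less_imp_le_powr:
  fixes u w :: real
  assumes "1 < p" "q = p / (p - 1)" "0 \<le> u" "0 \<le> w"
  shows "u powr p < w powr q \<Longrightarrow> u \<le> w powr (q - 1)"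
    and "w powr q < u powr p \<Longrightarrow> w powr (q - 1) \<le> u"
proof -
  have "q / p = q - 1" using assms by (simp add: field_simps)
  then have *: "(u powr p) powr (1 / p) = u" "(w powr q) powr (1 / p) = w powr (q - 1)"
    using assms by (auto simp: powr_powr)
  show "u powr p < w powr q \<Longrightarrow> u \<le> w powr (q - 1)"
    using powr_mono2[of "1 / p" "u powr p" "w powr q"] assms * by auto
  show "w powr q < u powr p \<Longrightarrow> w powr (q - 1) \<le> u"
    using powr_mono2[of "1 / p" "w powr q" "u powr p"] assms * by auto
qed

text \<open>The two weights are reciprocal, so absorbing their square roots into \<open>a\<close>
  and \<open>b\<close> leaves the product \<open>a * b\<close> unchanged. Weighted estimates become
  quadratic forms in \<open>s\<close> and \<open>t\<close>.\<close>

lemma weighted_split: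
  fixes a b w q :: real
  assumes "0 < w"
  obtains s t where "s\<^sup>2 = w powr (2 - q) * a\<^sup>2" "t\<^sup>2 = w powr (q - 2) * b\<^sup>2" "s * t = a * b"
proof
  have sq: "(w powr (r / 2))\<^sup>2 = w powr r" for r
    by (simp add: power2_eq_square flip: powr_add)
  show "(w powr ((2 - q) / 2) * a)\<^sup>2 = w powr (2 - q) * a\<^sup>2"
    "(w powr ((q - 2) / 2) * b)\<^sup>2 = w powr (q - 2) * b\<^sup>2"
    by (simp_all only: power_mult_distrib sq)
  have "w powr ((2 - q) / 2) * w powr ((q - 2) / 2) = w powr 0"
    unfolding powr_add[symmetric] by (rule arg_cong[where f="(powr) w"]) (simp add: field_simps)
  then have "w powr ((2 - q) / 2) * w powr ((q - 2) / 2) = 1" using assms by simp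
  then show "w powr ((2 - q) / 2) * a * (w powr ((q - 2) / 2) * b) = a * b"
    by (metis mult.assoc mult.left_commute mult_1)
qed

text \<open>Separates the Hessian of the product into two pure second-order terms and two mixed
  terms, one for each matrix.\<close>

lemma sum_product_d2_split:
  "(\<Sum>k<n. product_d2 q (z, e) (f k, g k) (x k, y k)) =
    cmod e powr (2 - q) * (\<Sum>k<n. pow_d2 2 z (f k) (x k))
    + (2 * (2 - q) * cmod e powr (- q)) * (\<Sum>k<n. inner e (g k) * inner z (x k))
    + ((cmod z)\<^sup>2 * (\<Sum>k<n. pow_d2 (2 - q) e (g k) (y k))
    + (2 * (2 - q) * cmod e powr (- q)) * (\<Sum>k<n. inner z (f k) * inner e (y k)))"
proof -
  have "pow_d1 2 z d * pow_d1 (2 - q) e d' = 2 * (2 - q) * cmod e powr (- q) * (inner z d * inner e d')"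
    for d d'
    by (auto simp: pow_d1_def)
  moreover from this have "pow_d1 (2 - q) e d' * pow_d1 2 z d = 2 * (2 - q) * cmod e powr (- q) * (inner e d' * inner z d)"
    for d d'
    by (simp only: mult.commute)
  moreover have "cmod z powr 2 = (cmod z)\<^sup>2" by simp
  ultimately show ?thesis
    unfolding product_d2_def fst_conv snd_conv sum.distrib sum_distrib_left by (simp only: mult.commute)
qed

locale elliptic_pair =
  A: p_elliptic_matrix n A lam Lam p D + B: p_elliptic_matrix n B lam Lam p D
  for n A B lam Lam p D +
  fixes q :: real
  assumes q: "q = p / (p - 1)" and lam_le_Lam: "lam \<le> Lam"
begin

lemma q_bounds: "1 < q" "q \<le> 2"
  using A.p_ge_2 by (auto simp: q field_simps)

text \<open>Any nonnegative \<delta> works here, since it only enlarges the coefficients of two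
  nonnegative terms.\<close>

lemma gen_hess_bellman_Q_outer:
  assumes v: "snd v \<noteq> 0" "cmod (snd v) powr q < cmod (fst v) powr p"
    and x: "x \<in> carrier_vec n" and y: "y \<in> carrier_vec n" and "0 \<le> \<delta>"
  shows "D / 5 * (lam / Lam) * cvec_norm x * cvec_norm y \<le> gen_hess n (bellman_Q p \<delta>) A B v (x, y)"
proof -
  obtain z e where ze: "v = (z, e)" by (cases v)
  define u w a b c c' where "u = cmod z" "w = cmod e" "a = cvec_norm x" "b = cvec_norm y"
    "c = 1 + \<delta> * (2 / p)" "c' = 1 + \<delta> * (2 / q - 1)"
  note defs = this
  have w: "0 < w" and e: "e \<noteq> 0" and wu: "w powr q < u powr p"
    using v by (auto simp: ze defs)
  have "0 \<le> a" "0 \<le> b" by (auto simp: defs cvec_norm_nonneg)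
  have "1 \<le> c" "1 \<le> c'"
    using \<open>0 \<le> \<delta>\<close> A.p_ge_2 q_bounds by (auto simp: defs)
  let ?Sp = "\<Sum>k<n. pow_d2 p z ((A *\<^sub>v x) $ k) (x $ k)"
  let ?Sq = "\<Sum>k<n. pow_d2 q e ((B *\<^sub>v y) $ k) (y $ k)"
  have eq: "gen_hess n (bellman_Q p \<delta>) A B v (x, y) = c * ?Sp + c' * ?Sq"
  proof (subst gen_hess_eq_sum[OF A.carrier B.carrier x y bilinear_separate_d2])
    show "hess (bellman_Q p \<delta>) v $$ (i, j) = separate_d2 c c' p q v (coord_dir i) (coord_dir j)"
      if "i < 4" "j < 4" for i j
      unfolding defs using that by (rule hess_bellman_Q_outer[OF A.p_ge_2 q v])
  qed (simp add: separate_d2_def ze sum.distrib sum_distrib_left)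
  \<comment> \<open>Raising w^(q-1) \<le> u to the power p - 2 makes the weight of |\<omega>_1|^2 at
    least the reciprocal of the weight of |\<omega>_2|^2.\<close>
  have "(q - 1) * (p - 2) = 2 - q" using A.p_ge_2 by (simp add: q field_simps)
  moreover have "(w powr (q - 1)) powr (p - 2) \<le> u powr (p - 2)"
    using powr_less_imp_le_powr(2)[of p q u w] A.p_ge_2 q wu w
    by (intro powr_mono2) (auto simp: defs)
  ultimately have wu': "w powr (2 - q) \<le> u powr (p - 2)" by (simp add: powr_powr)
  have half: "1 / 2 * D * s \<le> r\<^sup>2 / 2 * D * s" if "1 \<le> r" "0 \<le> s" for r s :: real
    using that A.D_pos power_mono[of 1 r 2] by (intro mult_right_mono) auto
  have "1 / 2 * D * (w powr (2 - q) * a\<^sup>2) \<le> 1 / 2 * D * (u powr (p - 2) * a\<^sup>2)"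
    using wu' A.D_pos by (intro mult_left_mono mult_right_mono) auto
  also have "\<dots> \<le> p\<^sup>2 / 2 * D * (u powr (p - 2) * a\<^sup>2)"
    using A.p_ge_2 by (intro half) auto
  also have "\<dots> \<le> ?Sp"
    using A.sum_pow_d2_p[OF x, of z] by (simp add: defs mult.assoc)
  finally have Sp: "1 / 2 * D * (w powr (2 - q) * a\<^sup>2) \<le> ?Sp" .
  have "1 / 2 * D * (w powr (q - 2) * b\<^sup>2) \<le> q\<^sup>2 / 2 * D * (w powr (q - 2) * b\<^sup>2)"
    using q_bounds by (intro half) auto
  also have "\<dots> \<le> ?Sq"
    using B.sum_pow_d2_q[OF y e q] by (simp add: defs mult.assoc)
  finally have Sq: "1 / 2 * D * (w powr (q - 2) * b\<^sup>2) \<le> ?Sq" .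
  have "0 \<le> ?Sp" by (rule order_trans[OF _ Sp]) (use A.D_pos in auto)
  then have "1 * ?Sp \<le> c * ?Sp" using \<open>1 \<le> c\<close> by (intro mult_right_mono)
  moreover have "0 \<le> ?Sq" by (rule order_trans[OF _ Sq]) (use A.D_pos in auto)
  then have "1 * ?Sq \<le> c' * ?Sq" using \<open>1 \<le> c'\<close> by (intro mult_right_mono)
  moreover obtain s t where st: "s\<^sup>2 = w powr (2 - q) * a\<^sup>2" "t\<^sup>2 = w powr (q - 2) * b\<^sup>2"
    and ab: "s * t = a * b"
    using weighted_split[OF w] by blast
  moreover have "1 / 2 * D * (s\<^sup>2 + t\<^sup>2) - D * (s * t) = 1 / 2 * D * (s - t)\<^sup>2"
    by (simp add: power2_eq_square algebra_simps)
  moreover have "0 \<le> 1 / 2 * D * (s - t)\<^sup>2" using A.D_pos by simp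
  ultimately have "D * (a * b) \<le> gen_hess n (bellman_Q p \<delta>) A B v (x, y)"
    using Sp Sq unfolding eq st[symmetric] ab distrib_left by linarith
  \<comment> \<open>The bound obtained is stronger than required, as lam/Lam is at most 1.\<close>
  moreover have "(D * (a * b)) * (lam / Lam / 5) \<le> (D * (a * b)) * 1"
    using A.D_pos A.lam_pos lam_le_Lam \<open>0 \<le> a\<close> \<open>0 \<le> b\<close>
    by (intro mult_left_mono) (auto simp: field_simps)
  ultimately show ?thesis by (simp add: defs mult_ac)
qed

lemma gen_hess_bellman_Q_inner:
  assumes v: "snd v \<noteq> 0" "cmod (fst v) powr p < cmod (snd v) powr q"
    and x: "x \<in> carrier_vec n" and y: "y \<in> carrier_vec n" and \<delta>: "\<delta> = D * lam / (20 * Lam\<^sup>2)"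
  shows "D / 5 * (lam / Lam) * cvec_norm x * cvec_norm y \<le> gen_hess n (bellman_Q p \<delta>) A B v (x, y)"
proof -
  obtain z e where ze: "v = (z, e)" by (cases v)
  define u w a b where "u = cmod z" "w = cmod e" "a = cvec_norm x" "b = cvec_norm y"
  note defs = this
  have w: "0 < w" and e: "e \<noteq> 0" and uw: "u powr p < w powr q" and u: "0 \<le> u"
    using v by (auto simp: ze defs)
  have a: "0 \<le> a" and b: "0 \<le> b" by (auto simp: defs cvec_norm_nonneg)
  have "0 \<le> \<delta>" using A.D_pos A.lam_pos by (simp add: \<delta>)
  let ?Sp = "\<Sum>k<n. pow_d2 p z ((A *\<^sub>v x) $ k) (x $ k)"
  let ?Sq = "\<Sum>k<n. pow_d2 q e ((B *\<^sub>v y) $ k) (y $ k)"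
  let ?S1 = "\<Sum>k<n. pow_d2 2 z ((A *\<^sub>v x) $ k) (x $ k)"
  let ?S2 = "\<Sum>k<n. pow_d2 (2 - q) e ((B *\<^sub>v y) $ k) (y $ k)"
  let ?S3 = "\<Sum>k<n. inner e ((B *\<^sub>v y) $ k) * inner z (x $ k)"
  let ?S4 = "\<Sum>k<n. inner z ((A *\<^sub>v x) $ k) * inner e (y $ k)"
  have eq: "gen_hess n (bellman_Q p \<delta>) A B v (x, y) = ?Sp + ?Sq + \<delta> * (w powr (2 - q) * ?S1
      + (2 * (2 - q) * w powr (- q)) * ?S3 + (u\<^sup>2 * ?S2 + (2 * (2 - q) * w powr (- q)) * ?S4))"
  proof (subst gen_hess_eq_sum[OF A.carrier B.carrier x y
        bilinear_add_scale[OF bilinear_separate_d2 bilinear_product_d2]])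
    show "hess (bellman_Q p \<delta>) v $$ (i, j) = separate_d2 1 1 p q v (coord_dir i) (coord_dir j)
        + \<delta> * product_d2 q v (coord_dir i) (coord_dir j)" if "i < 4" "j < 4" for i j
      using that by (rule hess_bellman_Q_inner[OF A.p_ge_2 q v])
  next
    show "(\<Sum>k<n. separate_d2 1 1 p q v ((A *\<^sub>v x) $ k, (B *\<^sub>v y) $ k) (x $ k, y $ k)
        + \<delta> * product_d2 q v ((A *\<^sub>v x) $ k, (B *\<^sub>v y) $ k) (x $ k, y $ k)) = ?Sp + ?Sq
        + \<delta> * (w powr (2 - q) * ?S1 + (2 * (2 - q) * w powr (- q)) * ?S3
        + (u\<^sup>2 * ?S2 + (2 * (2 - q) * w powr (- q)) * ?S4))"
      unfolding sum.distrib sum_distrib_left[symmetric] ze sum_product_d2_split defs separate_d2_def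
      by (simp add: sum.distrib)
  qed
  \<comment> \<open>The region inequality enters twice: as \<open>u2\<close> for the pure error term
    and as \<open>u1\<close> for the mixed ones.\<close>
  have u_le: "u \<le> w powr (q - 1)"
    using powr_less_imp_le_powr(1)[of p q u w] A.p_ge_2 q uw w u by auto
  then have "u\<^sup>2 \<le> (w powr (q - 1))\<^sup>2" using u by (rule power_mono)
  then have "w powr (- q) * u\<^sup>2 \<le> w powr (- q) * (w powr (q - 1))\<^sup>2"
    by (intro mult_left_mono) auto
  also have "\<dots> = w powr (q - 2)"
    using w by (simp add: powr_power flip: powr_add)
  finally have u2: "w powr (- q) * u\<^sup>2 \<le> w powr (q - 2)" .
  have "w powr (- q) * (u * w) \<le> w powr (- q) * (w powr (q - 1) * w powr 1)"
    using u_le w by (intro mult_left_mono) auto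
  also have "\<dots> = 1" using w unfolding powr_add[symmetric] by simp
  finally have u1: "w powr (- q) * (u * w) \<le> 1" .

  \<comment> \<open>Only the sign of the |\<zeta>|^p term is kept: its weight vanishes at \<zeta> =
    0.\<close>
  have "0 \<le> p\<^sup>2 / 2 * D * u powr (p - 2) * a\<^sup>2" using A.D_pos by simp
  then have Sp: "0 \<le> ?Sp" using A.sum_pow_d2_p[OF x, of z] by (simp add: defs)
  have "1 / 2 * D * (w powr (q - 2) * b\<^sup>2) \<le> q\<^sup>2 / 2 * D * (w powr (q - 2) * b\<^sup>2)"
    using q_bounds A.D_pos power_mono[of 1 q 2] by (intro mult_right_mono) auto
  also have "\<dots> \<le> ?Sq"
    using B.sum_pow_d2_q[OF y e q] by (simp add: defs mult.assoc)
  finally have Sq: "1 / 2 * D * (w powr (q - 2) * b\<^sup>2) \<le> ?Sq" .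
  have S1: "2 * lam * (w powr (2 - q) * a\<^sup>2) \<le> w powr (2 - q) * ?S1"
    using mult_left_mono[OF A.sum_pow_d2_2[OF x, of z], of "w powr (2 - q)"] by (simp add: defs mult_ac)
  have S2: "- (Lam * (w powr (q - 2) * b\<^sup>2)) \<le> u\<^sup>2 * ?S2"
  proof -
    have "\<bar>u\<^sup>2 * ?S2\<bar> \<le> u\<^sup>2 * ((2 - q) * w powr (- q) * Lam * b\<^sup>2)"
      unfolding abs_mult using B.abs_sum_pow_d2_2_minus[OF y e, of q] q_bounds
      by (simp add: defs mult_left_mono)
    also have "\<dots> = (2 - q) * ((w powr (- q) * u\<^sup>2) * (Lam * b\<^sup>2))" by simp
    also have "\<dots> \<le> 1 * (w powr (q - 2) * (Lam * b\<^sup>2))"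
      using u2 q_bounds A.Lam_pos by (intro mult_mono mult_right_mono) auto
    finally show ?thesis by (simp add: mult_ac)
  qed
  \<comment> \<open>One estimate for both mixed sums; 2 (2 - q) is at most 2 because q > 1.\<close>
  have S34: "- (2 * (Lam * (a * b))) \<le> (2 * (2 - q) * w powr (- q)) * S"
    if "\<bar>S\<bar> \<le> Lam * (u * w) * (a * b)" for S
  proof -
    have "\<bar>(2 * (2 - q) * w powr (- q)) * S\<bar> \<le> (2 * (2 - q) * w powr (- q)) * (Lam * (u * w) * (a * b))"
      unfolding abs_mult using that q_bounds by (simp add: mult_left_mono)
    also have "\<dots> = (2 * (2 - q)) * ((w powr (- q) * (u * w)) * (Lam * (a * b)))" by simp
    also have "\<dots> \<le> 2 * (1 * (Lam * (a * b)))"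
      using u1 u w q_bounds A.Lam_pos a b by (intro mult_mono mult_right_mono) auto
    finally show ?thesis by simp
  qed
  have S3: "- (2 * (Lam * (a * b))) \<le> (2 * (2 - q) * w powr (- q)) * ?S3"
    using B.abs_sum_inner_mult_inner[OF y x, of e z] by (intro S34) (simp add: defs mult_ac)
  have S4: "- (2 * (Lam * (a * b))) \<le> (2 * (2 - q) * w powr (- q)) * ?S4"
    using A.abs_sum_inner_mult_inner[OF x y, of z e] by (intro S34) (simp add: defs mult_ac)

  obtain s t where st: "s\<^sup>2 = w powr (2 - q) * a\<^sup>2" "t\<^sup>2 = w powr (q - 2) * b\<^sup>2"
    and ab: "s * t = a * b"
    using weighted_split[OF w] by blast
  have "\<delta> * (2 * lam * s\<^sup>2 - Lam * t\<^sup>2 - 4 * (Lam * (s * t))) \<le> \<delta> * (w powr (2 - q) * ?S1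
      + (2 * (2 - q) * w powr (- q)) * ?S3 + (u\<^sup>2 * ?S2 + (2 * (2 - q) * w powr (- q)) * ?S4))"
    using S1 S2 S3 S4 unfolding st ab by (intro mult_left_mono \<open>0 \<le> \<delta>\<close>) linarith
  then have "1 / 2 * D * t\<^sup>2 + \<delta> * (2 * lam * s\<^sup>2 - Lam * t\<^sup>2 - 4 * (Lam * (s * t)))
      \<le> gen_hess n (bellman_Q p \<delta>) A B v (x, y)"
    using Sp Sq unfolding eq st(2) by linarith
  \<comment> \<open>In terms of \<open>r\<close>, the choice of \<delta> makes the coefficients of
    s^2 and st proportional to r^2 and r, as in a square of \<open>r * s\<close> minus a multiple of
    \<open>t\<close>.\<close>
  moreover define r where "r = lam / Lam"
  have r: "0 \<le> r" "r \<le> 1" and \<delta>': "\<delta> * lam = D * r\<^sup>2 / 20" "\<delta> * Lam = D * r / 20"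
    using A.lam_pos A.Lam_pos lam_le_Lam by (auto simp: r_def \<delta> power2_eq_square field_simps)
  have "1 / 2 * D * t\<^sup>2 + \<delta> * (2 * lam * s\<^sup>2 - Lam * t\<^sup>2 - 4 * (Lam * (s * t))) =
      1 / 2 * D * t\<^sup>2 + 2 * (\<delta> * lam) * s\<^sup>2 - (\<delta> * Lam) * t\<^sup>2 - 4 * (\<delta> * Lam) * (s * t)"
    by (simp add: algebra_simps)
  \<comment> \<open>The square uses up the s^2 term and turns the mixed coefficient from -Dr/5 into
    Dr/5. Of D t^2/2 it takes 2D/5; the remaining D/10 covers the loss Dr/20, as r \<le> 1.\<close>
  also have "\<dots> = D / 5 * r * (s * t) + D / 10 * (r * s - 2 * t)\<^sup>2 + D / 20 * (1 - r) * t\<^sup>2 + D / 20 * t\<^sup>2"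
    unfolding \<delta>' by (simp add: power2_eq_square field_simps)
  moreover have "0 \<le> D / 10 * (r * s - 2 * t)\<^sup>2" "0 \<le> D / 20 * (1 - r) * t\<^sup>2" "0 \<le> D / 20 * t\<^sup>2"
    using A.D_pos r by auto
  ultimately have "D / 5 * r * (s * t) \<le> gen_hess n (bellman_Q p \<delta>) A B v (x, y)"
    by linarith
  then show ?thesis unfolding ab by (simp add: r_def defs mult.assoc)
qed

end

section \<open>From the essential infimum to inequalities at almost every point\<close>

lemma cvec_norm_I_op_le:
  assumes "2 \<le> p"
  shows "cvec_norm (I_op p x) \<le> 2 * cvec_norm x"
proof (rule power2_le_imp_le)
  have "(cvec_norm (I_op p x))\<^sup>2 = (\<Sum>k<dim_vec x. (cmod (x $ k + complex_of_real (1 - 2 / p) * cnj (x $ k)))\<^sup>2)"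
    using cvec_norm_power2[of "I_op p x" "dim_vec x"] by (simp add: I_op_def)
  also have "\<dots> \<le> (\<Sum>k<dim_vec x. (2 * cmod (x $ k))\<^sup>2)"
  proof (intro sum_mono power_mono)
    fix k
    have "cmod (complex_of_real (1 - 2 / p) * cnj (x $ k)) \<le> 1 * cmod (x $ k)"
      unfolding norm_mult norm_of_real complex_mod_cnj
      using assms by (intro mult_right_mono) (auto simp: abs_le_iff)
    then show "cmod (x $ k + complex_of_real (1 - 2 / p) * cnj (x $ k)) \<le> 2 * cmod (x $ k)"
      using norm_triangle_ineq[of "x $ k" "complex_of_real (1 - 2 / p) * cnj (x $ k)"] by linarith
  qed simp
  also have "\<dots> = (2 * cvec_norm x)\<^sup>2"
    using cvec_norm_power2[of x "dim_vec x"] by (simp add: power_mult_distrib sum_distrib_left)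
  finally show "(cvec_norm (I_op p x))\<^sup>2 \<le> (2 * cvec_norm x)\<^sup>2" .
qed (simp add: cvec_norm_nonneg)

context elliptic_matrix
begin

text \<open>Makes the infimum over the sphere one of a bounded set, and later bounds
  \<open>D\<close> by a multiple of \<Lambda>.\<close>

lemma abs_Re_I_op_le:
  assumes x: "x \<in> carrier_vec n" and p: "2 \<le> p"
  shows "\<bar>Re ((A *\<^sub>v x) \<bullet>c I_op p x)\<bar> \<le> 2 * Lam * (cvec_norm x)\<^sup>2"
proof -
  have "I_op p x \<in> carrier_vec n" using x by (simp add: I_op_def)
  then have "\<bar>Re ((A *\<^sub>v x) \<bullet>c I_op p x)\<bar> \<le> Lam * cvec_norm x * cvec_norm (I_op p x)"
    using upper[OF x] abs_Re_le_cmod order_trans by blast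
  also have "\<dots> \<le> Lam * cvec_norm x * (2 * cvec_norm x)"
    using Lam_pos cvec_norm_nonneg cvec_norm_I_op_le[OF p] by (intro mult_left_mono) auto
  finally show ?thesis by (simp add: power2_eq_square mult_ac)
qed

text \<open>Both sides are homogeneous of degree 2 under real scaling, so the unit sphere
  suffices.\<close>

lemma INF_imp_lower:
  assumes x: "x \<in> carrier_vec n" and p: "2 \<le> p"
    and d: "d \<le> (INF \<xi>\<in>{\<xi> \<in> carrier_vec n. cvec_norm \<xi> = 1}. Re ((A *\<^sub>v \<xi>) \<bullet>c I_op p \<xi>))"
  shows "d * (cvec_norm x)\<^sup>2 \<le> Re ((A *\<^sub>v x) \<bullet>c I_op p x)"
proof (cases "cvec_norm x = 0")
  case True
  then show ?thesis using abs_Re_I_op_le[OF x p] by simp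
next
  case False
  define t where "t = cvec_norm x"
  have t: "0 < t" using False cvec_norm_nonneg[of x] by (simp add: t_def)
  define y where "y = complex_of_real (1 / t) \<cdot>\<^sub>v x"
  have y: "y \<in> carrier_vec n" "cvec_norm y = 1"
    using x t by (simp_all add: y_def cvec_norm_smult t_def[symmetric] norm_divide)
  have dims: "dim_vec x = n" using x by simp
  \<comment> \<open>This needs the scalar to be real, since \<open>I_op\<close> contains a
    conjugation.\<close>
  have I: "I_op p y = complex_of_real (1 / t) \<cdot>\<^sub>v I_op p x"
    by (intro eq_vecI) (simp_all add: y_def I_op_def algebra_simps)
  have "d \<le> Re ((A *\<^sub>v y) \<bullet>c I_op p y)"
  proof (rule order_trans[OF d], rule cINF_lower)
    show "bdd_below ((\<lambda>\<xi>. Re ((A *\<^sub>v \<xi>) \<bullet>c I_op p \<xi>)) ` {\<xi> \<in> carrier_vec n. cvec_norm \<xi> = 1})"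
    proof (rule bdd_belowI2)
      show "- (2 * Lam) \<le> Re ((A *\<^sub>v \<xi>) \<bullet>c I_op p \<xi>)"
        if "\<xi> \<in> {\<xi> \<in> carrier_vec n. cvec_norm \<xi> = 1}" for \<xi>
        using abs_Re_I_op_le[of \<xi> p] that p by simp
    qed
  qed (use y in simp)
  also have "A *\<^sub>v y = complex_of_real (1 / t) \<cdot>\<^sub>v (A *\<^sub>v x)"
    unfolding y_def by (rule mult_mat_vec[OF carrier x])
  also have "Re (\<dots> \<bullet>c I_op p y) = (1 / t)\<^sup>2 * Re ((A *\<^sub>v x) \<bullet>c I_op p x)"
    unfolding I Re_cscalar_prod_eq_sum sum_distrib_left using carrier dims
    by (intro sum.cong) (auto simp: I_op_def inner_complex_def power2_eq_square algebra_simps)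
  finally show ?thesis using t by (simp add: t_def[symmetric] power_divide field_simps)
qed

text \<open>Test on a unit vector, which exists as \<open>n\<close> is positive. This keeps the
  chosen \<delta> below 1.\<close>

lemma p_lower_bound_le:
  assumes "1 \<le> n" and p: "2 \<le> p"
    and d: "\<And>x. x \<in> carrier_vec n \<Longrightarrow> d * (cvec_norm x)\<^sup>2 \<le> Re ((A *\<^sub>v x) \<bullet>c I_op p x)"
  shows "d \<le> 2 * Lam"
proof -
  have u: "unit_vec n 0 \<in> carrier_vec n" by simp
  have "(cvec_norm (unit_vec n 0))\<^sup>2 = (\<Sum>k<n. if k = 0 then 1 else 0)"
    unfolding cvec_norm_power2[OF u] by (intro sum.cong) auto
  then have "(cvec_norm (unit_vec n 0))\<^sup>2 = 1" using \<open>1 \<le> n\<close> by simp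
  then show ?thesis using d[OF u] abs_Re_I_op_le[OF u p] by simp
qed

end

text \<open>A lower bound on \<open>Liminf\<close> yields only strict bounds below \<open>d\<close>;
  countably many of them, d - 1/(m+1), hold simultaneously almost everywhere.\<close>

lemma AE_INF_ge_Delta:
  assumes "ereal d \<le> Delta n p \<Omega> A"
  shows "AE x in lebesgue_dim_on n \<Omega>.
    d \<le> (INF \<xi>\<in>{\<xi> \<in> carrier_vec n. cvec_norm \<xi> = 1}. Re ((A x *\<^sub>v \<xi>) \<bullet>c I_op p \<xi>))"
    (is "AE x in ?M. d \<le> ?g x")
proof -
  have "AE x in ?M. \<forall>m. d - inverse (real (Suc m)) < ?g x"
    unfolding AE_all_countable
  proof
    fix m
    have "ereal (d - inverse (real (Suc m))) < ereal d" by simp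
    with assms have "AE x in ?M. ereal (d - inverse (real (Suc m))) < ereal (?g x)"
      unfolding Delta_def le_Liminf_iff by blast
    then show "AE x in ?M. d - inverse (real (Suc m)) < ?g x" by simp
  qed
  then show ?thesis
  proof eventually_elim
    case (elim x)
    show ?case
    proof (rule field_le_epsilon)
      fix \<epsilon> :: real assume "0 < \<epsilon>"
      then obtain m where "inverse (real (Suc m)) < \<epsilon>" using reals_Archimedean by blast
      then show "d \<le> ?g x + \<epsilon>" using elim[rule_format, of m] by linarith
    qed
  qed
qed

text \<open>A real number cannot exceed every natural number, so an infinite essential infimum
  forces \<Omega> to be a null set.\<close>

lemma AE_False_if_Delta_infinite:
  assumes "Delta n p \<Omega> A = \<infinity>"
  shows "AE x in lebesgue_dim_on n \<Omega>. False"
proof -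
  have "AE x in lebesgue_dim_on n \<Omega>. \<forall>m::nat. real m \<le> (INF \<xi>\<in>{\<xi> \<in> carrier_vec n. cvec_norm \<xi> = 1}. Re ((A x *\<^sub>v \<xi>) \<bullet>c I_op p \<xi>))"
    unfolding AE_all_countable using AE_INF_ge_Delta[of _ n p \<Omega> A] assms by auto
  then show ?thesis
    by eventually_elim (meson not_less reals_Archimedean2)
qed

lemma AE_elliptic_matrix:
  assumes "A \<in> elliptic n lam Lam \<Omega>" "0 < lam" "lam \<le> Lam"
  shows "AE x in lebesgue_dim_on n \<Omega>. elliptic_matrix n (A x) lam Lam"
proof -
  have "AE x in lebesgue_dim_on n \<Omega>. \<forall>\<xi>\<in>carrier_vec n. \<forall>\<eta>\<in>carrier_vec n.
        Re ((A x *\<^sub>v \<xi>) \<bullet>c \<xi>) \<ge> lam * (cvec_norm \<xi>)\<^sup>2 \<and>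
        cmod ((A x *\<^sub>v \<xi>) \<bullet>c \<eta>) \<le> Lam * cvec_norm \<xi> * cvec_norm \<eta>"
    using assms(1) by (simp add: elliptic_def)
  \<comment> \<open>\<open>elliptic\<close> fixes the dimensions of \<open>A x\<close> only on
    \<Omega>, so membership of \<open>x\<close> must be at hand.\<close>
  with AE_space show ?thesis
  proof eventually_elim
    case (elim x)
    then have "A x \<in> carrier_mat n n"
      using assms(1) by (auto simp: elliptic_def lebesgue_dim_on_def space_restrict_space)
    with elim assms(2,3) show ?case by unfold_locales auto
  qed
qed

lemma AE_p_elliptic_matrix:
  assumes "A \<in> elliptic n lam Lam \<Omega>" "0 < lam" "lam \<le> Lam" "2 \<le> p" "0 < d" "ereal d \<le> Delta n p \<Omega> A"
  shows "AE x in lebesgue_dim_on n \<Omega>. p_elliptic_matrix n (A x) lam Lam p d"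
  using AE_elliptic_matrix[OF assms(1-3)] AE_INF_ge_Delta[OF assms(6)]
proof eventually_elim
  case (elim x)
  then interpret elliptic_matrix n "A x" lam Lam by simp
  show ?case using assms INF_imp_lower elim by unfold_locales auto
qed

section \<open>Choice of \<delta> and passage to almost every point\<close>

theorem theorem5p2:
  shows "\<exists>\<delta> :: real \<Rightarrow> real \<Rightarrow> real \<Rightarrow> real.
    \<forall>(n::nat) (p::real) (q::real) (lam::real) (Lam::real) (\<Omega> :: (nat \<Rightarrow> real) set)
      (A :: (nat \<Rightarrow> real) \<Rightarrow> complex mat) (B :: (nat \<Rightarrow> real) \<Rightarrow> complex mat) (D::ereal).
      n \<ge> 1 \<longrightarrow> p \<ge> 2 \<longrightarrow> 1 / p + 1 / q = 1 \<longrightarrow> Lam \<ge> lam \<longrightarrow> lam > 0 \<longrightarrow>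
      openin (euclidean_top n) \<Omega> \<longrightarrow>
      A \<in> elliptic n lam Lam \<Omega> \<longrightarrow> B \<in> elliptic n lam Lam \<Omega> \<longrightarrow>
      D = min (Delta n p \<Omega> A) (Delta n p \<Omega> B) \<longrightarrow> D > 0 \<longrightarrow>
      0 < \<delta> (real_of_ereal D) lam Lam \<and> \<delta> (real_of_ereal D) lam Lam < 1 \<and>
      (AE x in lebesgue_dim_on n \<Omega>.
        \<forall>v \<in> - Upsilon p q. \<forall>\<omega>\<^sub>1 \<in> carrier_vec n. \<forall>\<omega>\<^sub>2 \<in> carrier_vec n.
          gen_hess n (bellman_Q p (\<delta> (real_of_ereal D) lam Lam)) (A x) (B x) v (\<omega>\<^sub>1, \<omega>\<^sub>2)
            \<ge> real_of_ereal D / 5 * (lam / Lam) * cvec_norm \<omega>\<^sub>1 * cvec_norm \<omega>\<^sub>2)"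
proof -
  define \<delta> where "\<delta> d lam Lam = (let c = d * lam / (20 * Lam\<^sup>2) in if 0 < c \<and> c < 1 then c else 1 / 2)"
    for d lam Lam :: real
    \<comment> \<open>\<open>1/2\<close> serves \<open>D = \<infinity>\<close>, where \<open>real_of_ereal D = 0\<close>.\<close>
  have \<delta>_bounds: "0 < \<delta> d lam Lam" "\<delta> d lam Lam < 1" for d lam Lam
    by (simp_all add: \<delta>_def Let_def)
  show ?thesis
  proof (intro exI[of _ \<delta>] allI impI conjI \<delta>_bounds)
    fix n p q lam Lam \<Omega> A B and D :: ereal
    assume n: "1 \<le> n" and p: "2 \<le> p" and pq: "1 / p + 1 / q = 1"
      and lam: "lam \<le> Lam" "0 < lam"
      and A: "A \<in> elliptic n lam Lam \<Omega>" and B: "B \<in> elliptic n lam Lam \<Omega>"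
      and D: "D = min (Delta n p \<Omega> A) (Delta n p \<Omega> B)" "0 < D"
    \<comment> \<open>With 1/0 = 0, the value q = 0 would force p = 1.\<close>
    have "q \<noteq> 0" using pq p by auto
    then have q: "q = p / (p - 1)" using pq p by (simp add: field_simps)
    show "AE x in lebesgue_dim_on n \<Omega>.
        \<forall>v \<in> - Upsilon p q. \<forall>\<omega>\<^sub>1 \<in> carrier_vec n. \<forall>\<omega>\<^sub>2 \<in> carrier_vec n.
          gen_hess n (bellman_Q p (\<delta> (real_of_ereal D) lam Lam)) (A x) (B x) v (\<omega>\<^sub>1, \<omega>\<^sub>2)
            \<ge> real_of_ereal D / 5 * (lam / Lam) * cvec_norm \<omega>\<^sub>1 * cvec_norm \<omega>\<^sub>2"
    proof (cases D)
      case PInf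
      with D(1) have "Delta n p \<Omega> A = \<infinity>" by (simp add: min_def split: if_splits)
      from AE_False_if_Delta_infinite[OF this] show ?thesis by eventually_elim simp
    next
      case (real d)
      then have "0 < d" using D(2) by simp
      with real D(1) have d: "0 < d" "ereal d \<le> Delta n p \<Omega> A" "ereal d \<le> Delta n p \<Omega> B"
        by (auto simp: min_def split: if_splits)
      from AE_p_elliptic_matrix[OF A lam(2,1) p d(1,2)] AE_p_elliptic_matrix[OF B lam(2,1) p d(1,3)]
      show ?thesis
      proof eventually_elim
        case (elim x)
        then interpret elliptic_pair n "A x" "B x" lam Lam p d q
          using q lam by (intro elliptic_pair.intro elliptic_pair_axioms.intro)
        \<comment> \<open>Hence the quotient defining \<delta> is at most 1/10 and the guard in its
          definition holds.\<close>
        have "d \<le> 2 * Lam" using A.p_lower_bound_le[OF n p] A.p_lower by blast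
        then have "d * lam \<le> 2 * Lam * Lam" using lam d by (intro mult_mono) auto
        moreover have "0 < Lam * Lam" using A.Lam_pos by simp
        ultimately have "d * lam < 20 * Lam\<^sup>2" unfolding power2_eq_square by linarith
        then have "d * lam / (20 * Lam\<^sup>2) < 1"
          using A.Lam_pos by (simp add: divide_less_eq)
        moreover have "0 < d * lam / (20 * Lam\<^sup>2)"
          using d lam A.Lam_pos by simp
        ultimately have \<delta>: "\<delta> d lam Lam = d * lam / (20 * Lam\<^sup>2)"
          by (simp add: \<delta>_def Let_def)
        show ?case
        proof (intro ballI)
          fix v and \<omega>\<^sub>1 \<omega>\<^sub>2 :: "complex vec"
          assume v: "v \<in> - Upsilon p q" and \<omega>: "\<omega>\<^sub>1 \<in> carrier_vec n" "\<omega>\<^sub>2 \<in> carrier_vec n"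
          from v have "snd v \<noteq> 0" "cmod (fst v) powr p \<noteq> cmod (snd v) powr q"
            by (auto simp: Upsilon_def split: prod.splits)
          then have "snd v \<noteq> 0" "cmod (fst v) powr p < cmod (snd v) powr q \<or> cmod (snd v) powr q < cmod (fst v) powr p"
            by auto
          then show "gen_hess n (bellman_Q p (\<delta> (real_of_ereal D) lam Lam)) (A x) (B x) v (\<omega>\<^sub>1, \<omega>\<^sub>2)
            \<ge> real_of_ereal D / 5 * (lam / Lam) * cvec_norm \<omega>\<^sub>1 * cvec_norm \<omega>\<^sub>2"
            unfolding real real_of_ereal.simps
            using gen_hess_bellman_Q_inner[OF _ _ \<omega> \<delta>, of v]
              gen_hess_bellman_Q_outer[OF _ _ \<omega>, of v "\<delta> d lam Lam"] \<delta>_bounds(1)[of d lam Lam]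
            by auto
        qed
      qed
    qed (use D in auto)
  qed
qed

end
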